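(* Let $K\subset\mathbb{R}^3$ be a generic knot and let $\varepsilon>0$ be sufficiently small. Then, outside of a small neighborhood of the diagonal, i.e. restricted to $\{(s_1,\theta_1,s_2,\theta_2)\,:\,\widetilde d(s_1,s_2)\ge\delta_K\}$ for a fixed sufficiently small constant $\delta_K>0$, the space $M_{K,\varepsilon}$ of outward-pointing chords on the torus $T_{K,\varepsilon}$ is a $4$-dimensional manifold with corners.
   Context: $K\subset\mathbb{R}^3$ is a smooth knot of length $T$ with arc-length parametrization $\gamma:\mathbb{R}/T\mathbb{Z}\to\mathbb{R}^3$; $\langle\cdot,\cdot\rangle$ is the Euclidean inner product; $\kappa$ is the curvature, $n=\ddot\gamma/\|\ddot\gamma\|$, $b=\dot\gamma\times n$. Put $v(s,\theta)=\cos(\theta)n(s)+\sin(\theta)b(s)$ and $\Gamma_\varepsilon(s,\theta)=\gamma(s)+\varepsilon v(s,\theta)$ for $(s,\theta)\in\mathbb{R}/T\mathbb{Z}\times S^1$, $S^1=\mathbb{R}/2\pi\mathbb{Z}$. For small $\varepsilon>0$, $\Gamma_\varepsilon$ is an embedding with image the torus $T_{K,\varepsilon}$, the boundary of the $\varepsilon$-tubular neighborhood of $K$. For $i=1,2$ put $F_i^{[\varepsilon]}(s_1,\theta_1,s_2,\theta_2)=\langle\Gamma_\varepsilon(s_2,\theta_2)-\Gamma_\varepsilon(s_1,\theta_1),v(s_i,\theta_i)\rangle$ on $(\mathbb{R}/T\mathbb{Z}\times S^1)^2$. The space of outward-pointing chords is $$M_{K,\varepsilon}=\overline{\{(s_1,\theta_1,s_2,\theta_2)\in(\mathbb{R}/T\mathbb{Z}\times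 S^1)^2 : F_1^{[\varepsilon]}\ge0,\ F_2^{[\varepsilon]}\ge0,\ s_1\ne s_2\}}.$$ $\widetilde d$ is the flat distance on $\mathbb{R}/T\mathbb{Z}$. Generic knot: a pair $(s_1,s_2)$, $s_1\neq s_2$, is $s_1$-special if the tangent line of $K$ at $\gamma(s_1)$ passes through $\gamma(s_2)$, and $s_2$-special if the tangent line at $\gamma(s_2)$ passes through $\gamma(s_1)$. $K$ is generic here if: its curvature vanishes nowhere; there are only finitely many special pairs; for every $s_1$-special pair the tangent line at $\gamma(s_2)$ does not lie in the osculating plane at $\gamma(s_1)$ (and symmetrically for $s_2$-special pairs); and no two distinct points of $K$ have the same tangent line. The constant $\delta_K>0$ is fixed so small that the set $\{\widetilde d(s_1,s_2)\le\delta_K\}$ and the closed squares of half-side $\delta_K$ centered at the special pairs are pairwise disjoint. *)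

theory Defs
  imports "HOL-Analysis.Analysis"
begin

section \<open>Smooth maps\<close>

text \<open>Meant for open \<open>S\<close>, where it is the usual class of \<open>k\<close> times continuously
  differentiable maps.\<close>

primrec Ck_on :: "nat \<Rightarrow> 'a::euclidean_space set \<Rightarrow> ('a \<Rightarrow> 'b::real_normed_vector) \<Rightarrow> bool" where
  "Ck_on 0 S f \<longleftrightarrow> continuous_on S f"
| "Ck_on (Suc k) S f \<longleftrightarrow>
     (\<forall>x\<in>S. f differentiable (at x)) \<and> (\<forall>v. Ck_on k S (\<lambda>x. frechet_derivative f (at x) v))"

definition smooth_on :: "'a::euclidean_space set \<Rightarrow> ('a \<Rightarrow> 'b::real_normed_vector) \<Rightarrow> bool" where
  "smooth_on S f \<longleftrightarrow> (\<forall>k. Ck_on k S f)"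

text \<open>On an arbitrary set, a smooth map is one that locally extends to a smooth map on an
  open set.\<close>

definition smooth_map_on :: "'a::euclidean_space set \<Rightarrow> ('a \<Rightarrow> 'b::real_normed_vector) \<Rightarrow> bool" where
  "smooth_map_on S f \<longleftrightarrow>
     (\<forall>x\<in>S. \<exists>U g. open U \<and> x \<in> U \<and> smooth_on U g \<and> (\<forall>y\<in>S \<inter> U. g y = f y))"


section \<open>Manifolds with corners\<close>

type_synonym ('a, 'n) chart = "'a set \<times> ('a \<Rightarrow> real ^ 'n)"

definition smooth_transition :: "('a, 'n::finite) chart \<Rightarrow> ('a, 'n) chart \<Rightarrow> bool" where
  "smooth_transition c d \<longleftrightarrow>
     smooth_map_on (snd c ` (fst c \<inter> fst d)) (snd d \<circ> inv_into (fst c) (snd c))"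

definition compatible :: "('a, 'n::finite) chart \<Rightarrow> ('a, 'n) chart \<Rightarrow> bool" where
  "compatible c d \<longleftrightarrow> smooth_transition c d \<and> smooth_transition d c"

text \<open>The local models: up to the order of coordinates, \<open>[0,\<infinity>)\<^sup>k \<times> \<real>\<^sup>n\<^sup>-\<^sup>k\<close> with \<open>k = card I\<close>.\<close>

definition sector :: "'n::finite set \<Rightarrow> (real ^ 'n) set" where
  "sector I = {x. \<forall>i\<in>I. 0 \<le> x $ i}"

definition corner_chart :: "'a topology \<Rightarrow> ('a, 'n::finite) chart \<Rightarrow> bool" where
  "corner_chart X c \<longleftrightarrow>
     openin X (fst c) \<and>
     (\<exists>I. openin (top_of_set (sector I)) (snd c ` fst c)) \<and>
     homeomorphic_map (subtopology X (fst c)) (top_of_set (snd c ` fst c)) (snd c)"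

text \<open>The dimension is \<open>CARD('n)\<close>.\<close>

definition manifold_with_corners :: "'a topology \<Rightarrow> ('a, 'n::finite) chart set \<Rightarrow> bool" where
  "manifold_with_corners X A \<longleftrightarrow>
     Hausdorff_space X \<and>
     (\<exists>B. countable B \<and> (\<forall>V\<in>B. openin X V) \<and>
          (\<forall>U x. openin X U \<and> x \<in> U \<longrightarrow> (\<exists>V\<in>B. x \<in> V \<and> V \<subseteq> U))) \<and>
     (\<forall>c\<in>A. corner_chart X c) \<and>
     (\<Union>c\<in>A. fst c) = topspace X \<and>
     (\<forall>c\<in>A. \<forall>d\<in>A. compatible c d)"

text \<open>Let \<open>\<A>\<close> be a smooth atlas of the space \<open>Q\<close>. A subset \<open>X\<close> of \<open>Q\<close>, with the subspace
  topology, is a manifold with corners of the same dimension as \<open>Q\<close>, for the smooth structure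
  inherited from \<open>Q\<close>: the transition maps between the charts of \<open>X\<close> and those of \<open>Q\<close> are
  required to be smooth. Without the last condition, any two homeomorphic subsets would be
  indistinguishable and corners could be straightened.\<close>

definition is_manifold_with_corners_in ::
    "'a topology \<Rightarrow> ('a, 'n::finite) chart set \<Rightarrow> 'a set \<Rightarrow> bool" where
  "is_manifold_with_corners_in Q \<A> X \<longleftrightarrow>
     (\<exists>A :: ('a, 'n) chart set.
        manifold_with_corners (subtopology Q X) A \<and> (\<forall>c\<in>A. \<forall>d\<in>\<A>. compatible c d))"


section \<open>The circle \<open>\<real>/P\<int>\<close> and the manifold \<open>(\<real>/T\<int> \<times> \<real>/2\<pi>\<int>)\<^sup>2\<close>\<close>

definition circle_class :: "real \<Rightarrow> real \<Rightarrow> real set" where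
  "circle_class P s = {s + of_int k * P | k :: int. True}"

text \<open>The quotient topology.\<close>

definition circle :: "real \<Rightarrow> real set topology" where
  "circle P = topology (\<lambda>U. U \<subseteq> range (circle_class P) \<and> open (circle_class P -` U))"

lemma openin_circle:
  "openin (circle P) U \<longleftrightarrow> U \<subseteq> range (circle_class P) \<and> open (circle_class P -` U)"
proof -
  have "istopology (\<lambda>U. U \<subseteq> range (circle_class P) \<and> open (circle_class P -` U))"
    unfolding istopology_def by (auto simp: vimage_Union)
  then show ?thesis
    unfolding circle_def by (simp add: topology_inverse')
qed

text \<open>The distance of two classes as sets of reals is their flat distance in \<open>\<real>/P\<int>\<close>.\<close>

definition circle_dist :: "real set \<Rightarrow> real set \<Rightarrow> real" where
  "circle_dist a b = setdist a b"

type_synonym torus_pair = "(real set \<times> real set) \<times> (real set \<times> real set)"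

definition chord_space :: "real \<Rightarrow> torus_pair topology" where
  "chord_space T =
     prod_topology (prod_topology (circle T) (circle (2 * pi)))
                   (prod_topology (circle T) (circle (2 * pi)))"

definition chord_class :: "real \<Rightarrow> real ^ 4 \<Rightarrow> torus_pair" where
  "chord_class T p =
     ((circle_class T (p $ 1), circle_class (2 * pi) (p $ 2)),
      (circle_class T (p $ 3), circle_class (2 * pi) (p $ 4)))"

text \<open>The standard smooth structure, given by the local inverses of the covering map from
  \<open>\<real>\<^sup>4\<close>.\<close>

definition chord_space_atlas :: "real \<Rightarrow> (torus_pair, 4) chart set" where
  "chord_space_atlas T =
     {(chord_class T ` V, inv_into V (chord_class T)) | V.
        open V \<and> inj_on (chord_class T) V}"


section \<open>Knots and their Frenet frames\<close>

text \<open>A map on \<open>\<real>/T\<int>\<close> is given by the corresponding \<open>T\<close>-periodic map on \<open>\<real>\<close>. The knot \<open>K\<close> is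
  the range of \<open>\<gamma>\<close>.\<close>

definition velocity :: "(real \<Rightarrow> real ^ 3) \<Rightarrow> real \<Rightarrow> real ^ 3" where
  "velocity \<gamma> s = vector_derivative \<gamma> (at s)"

definition acceleration :: "(real \<Rightarrow> real ^ 3) \<Rightarrow> real \<Rightarrow> real ^ 3" where
  "acceleration \<gamma> s = vector_derivative (velocity \<gamma>) (at s)"

definition smooth_knot :: "(real \<Rightarrow> real ^ 3) \<Rightarrow> real \<Rightarrow> bool" where
  "smooth_knot \<gamma> T \<longleftrightarrow>
     0 < T \<and> smooth_on UNIV \<gamma> \<and> (\<forall>s. norm (velocity \<gamma> s) = 1) \<and>
     (\<forall>s t. \<gamma> s = \<gamma> t \<longleftrightarrow> circle_class T s = circle_class T t)"

definition curvature :: "(real \<Rightarrow> real ^ 3) \<Rightarrow> real \<Rightarrow> real" where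
  "curvature \<gamma> s = norm (acceleration \<gamma> s)"

definition normal :: "(real \<Rightarrow> real ^ 3) \<Rightarrow> real \<Rightarrow> real ^ 3" where
  "normal \<gamma> s = acceleration \<gamma> s /\<^sub>R norm (acceleration \<gamma> s)"

definition binormal :: "(real \<Rightarrow> real ^ 3) \<Rightarrow> real \<Rightarrow> real ^ 3" where
  "binormal \<gamma> s = cross3 (velocity \<gamma> s) (normal \<gamma> s)"

definition tangent_line :: "(real \<Rightarrow> real ^ 3) \<Rightarrow> real \<Rightarrow> (real ^ 3) set" where
  "tangent_line \<gamma> s = {\<gamma> s + a *\<^sub>R velocity \<gamma> s | a. True}"

definition osculating_plane :: "(real \<Rightarrow> real ^ 3) \<Rightarrow> real \<Rightarrow> (real ^ 3) set" where
  "osculating_plane \<gamma> s = {\<gamma> s + a *\<^sub>R velocity \<gamma> s + b *\<^sub>R acceleration \<gamma> s | a b. True}"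


section \<open>Generic knots\<close>

definition first_special :: "(real \<Rightarrow> real ^ 3) \<Rightarrow> real \<Rightarrow> real \<Rightarrow> real \<Rightarrow> bool" where
  "first_special \<gamma> T s1 s2 \<longleftrightarrow>
     circle_class T s1 \<noteq> circle_class T s2 \<and> \<gamma> s2 \<in> tangent_line \<gamma> s1"

definition second_special :: "(real \<Rightarrow> real ^ 3) \<Rightarrow> real \<Rightarrow> real \<Rightarrow> real \<Rightarrow> bool" where
  "second_special \<gamma> T s1 s2 \<longleftrightarrow>
     circle_class T s1 \<noteq> circle_class T s2 \<and> \<gamma> s1 \<in> tangent_line \<gamma> s2"

definition special_pairs :: "(real \<Rightarrow> real ^ 3) \<Rightarrow> real \<Rightarrow> (real set \<times> real set) set" where
  "special_pairs \<gamma> T =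
     {(circle_class T s1, circle_class T s2) | s1 s2.
        first_special \<gamma> T s1 s2 \<or> second_special \<gamma> T s1 s2}"

definition generic_knot :: "(real \<Rightarrow> real ^ 3) \<Rightarrow> real \<Rightarrow> bool" where
  "generic_knot \<gamma> T \<longleftrightarrow>
     smooth_knot \<gamma> T \<and>
     (\<forall>s. curvature \<gamma> s \<noteq> 0) \<and>
     finite (special_pairs \<gamma> T) \<and>
     (\<forall>s1 s2. first_special \<gamma> T s1 s2 \<longrightarrow> \<not> tangent_line \<gamma> s2 \<subseteq> osculating_plane \<gamma> s1) \<and>
     (\<forall>s1 s2. second_special \<gamma> T s1 s2 \<longrightarrow> \<not> tangent_line \<gamma> s1 \<subseteq> osculating_plane \<gamma> s2) \<and>
     (\<forall>s1 s2. circle_class T s1 \<noteq> circle_class T s2 \<longrightarrow> tangent_line \<gamma> s1 \<noteq> tangent_line \<gamma> s2)"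

definition diagonal_band :: "real \<Rightarrow> real \<Rightarrow> (real set \<times> real set) set" where
  "diagonal_band T \<delta> =
     {(a, b). a \<in> range (circle_class T) \<and> b \<in> range (circle_class T) \<and> circle_dist a b \<le> \<delta>}"

definition closed_square :: "real \<Rightarrow> real \<Rightarrow> real set \<times> real set \<Rightarrow> (real set \<times> real set) set" where
  "closed_square T \<delta> c =
     {(a, b). a \<in> range (circle_class T) \<and> b \<in> range (circle_class T) \<and>
        circle_dist a (fst c) \<le> \<delta> \<and> circle_dist b (snd c) \<le> \<delta>}"

text \<open>The admissible values of \<open>\<delta>\<^sub>K\<close>. If there are special pairs, \<open>\<delta> < T / 2\<close> follows from the
  disjointness, because \<open>T / 2\<close> is the diameter of \<open>\<real>/T\<int>\<close>.\<close>

definition admissible_delta :: "(real \<Rightarrow> real ^ 3) \<Rightarrow> real \<Rightarrow> real \<Rightarrow> bool" where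
  "admissible_delta \<gamma> T \<delta> \<longleftrightarrow>
     0 < \<delta> \<and> \<delta> < T / 2 \<and>
     (\<forall>c\<in>special_pairs \<gamma> T. disjnt (diagonal_band T \<delta>) (closed_square T \<delta> c)) \<and>
     pairwise (\<lambda>c d. disjnt (closed_square T \<delta> c) (closed_square T \<delta> d)) (special_pairs \<gamma> T)"


section \<open>Outward-pointing chords\<close>

definition tube_normal :: "(real \<Rightarrow> real ^ 3) \<Rightarrow> real \<Rightarrow> real \<Rightarrow> real ^ 3" where
  "tube_normal \<gamma> s \<theta> = cos \<theta> *\<^sub>R normal \<gamma> s + sin \<theta> *\<^sub>R binormal \<gamma> s"

definition tube :: "(real \<Rightarrow> real ^ 3) \<Rightarrow> real \<Rightarrow> real \<Rightarrow> real \<Rightarrow> real ^ 3" where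
  "tube \<gamma> \<epsilon> s \<theta> = \<gamma> s + \<epsilon> *\<^sub>R tube_normal \<gamma> s \<theta>"

definition F1 :: "(real \<Rightarrow> real ^ 3) \<Rightarrow> real \<Rightarrow> real \<Rightarrow> real \<Rightarrow> real \<Rightarrow> real \<Rightarrow> real" where
  "F1 \<gamma> \<epsilon> s1 \<theta>1 s2 \<theta>2 = (tube \<gamma> \<epsilon> s2 \<theta>2 - tube \<gamma> \<epsilon> s1 \<theta>1) \<bullet> tube_normal \<gamma> s1 \<theta>1"

definition F2 :: "(real \<Rightarrow> real ^ 3) \<Rightarrow> real \<Rightarrow> real \<Rightarrow> real \<Rightarrow> real \<Rightarrow> real \<Rightarrow> real" where
  "F2 \<gamma> \<epsilon> s1 \<theta>1 s2 \<theta>2 = (tube \<gamma> \<epsilon> s2 \<theta>2 - tube \<gamma> \<epsilon> s1 \<theta>1) \<bullet> tube_normal \<gamma> s2 \<theta>2"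

definition outward_chords :: "(real \<Rightarrow> real ^ 3) \<Rightarrow> real \<Rightarrow> real \<Rightarrow> torus_pair set" where
  "outward_chords \<gamma> T \<epsilon> =
     chord_space T closure_of
       {((circle_class T s1, circle_class (2 * pi) \<theta>1),
         (circle_class T s2, circle_class (2 * pi) \<theta>2)) | s1 \<theta>1 s2 \<theta>2.
          F1 \<gamma> \<epsilon> s1 \<theta>1 s2 \<theta>2 \<ge> 0 \<and> F2 \<gamma> \<epsilon> s1 \<theta>1 s2 \<theta>2 \<ge> 0 \<and>
          circle_class T s1 \<noteq> circle_class T s2}"

definition off_diagonal :: "real \<Rightarrow> real \<Rightarrow> torus_pair set" where
  "off_diagonal T \<delta> =
     {p \<in> topspace (chord_space T). circle_dist (fst (fst p)) (fst (snd p)) \<ge> \<delta>}"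

end

theory Submission
  imports Defs
begin

text \<open>
  Write \<open>c = \<gamma>(s\<^sub>2) - \<gamma>(s\<^sub>1)\<close> and \<open>v\<^sub>i = v(s\<^sub>i, \<theta>\<^sub>i)\<close>. As \<open>v\<^sub>i\<close> is a unit vector,
  \<open>F\<^sub>1 = \<langle>c, v\<^sub>1\<rangle> + \<epsilon> (\<langle>v\<^sub>1, v\<^sub>2\<rangle> - 1)\<close> and \<open>F\<^sub>2 = \<langle>c, v\<^sub>2\<rangle> + \<epsilon> (1 - \<langle>v\<^sub>1, v\<^sub>2\<rangle>)\<close> are affine in \<open>\<epsilon>\<close>.
  At distance at least \<open>\<delta>\<close> from the diagonal the closure adds no chords, so there the space of
  outward-pointing chords is cut out by \<open>F\<^sub>1 \<ge> 0\<close>, \<open>F\<^sub>2 \<ge> 0\<close> and, near the boundary of the band, by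
  an inequality \<open>G \<ge> 0\<close> with \<open>G = \<plusminus>(s\<^sub>2 - s\<^sub>1) + w\<close>.

  The point is that this system is already transverse at \<open>\<epsilon> = 0\<close>: at every point at distance at
  least \<open>\<delta>\<close> from the diagonal the gradients of the constraints that vanish there are linearly
  independent. At \<open>\<epsilon> = 0\<close> the function \<open>F\<^sub>1 = \<langle>c, v\<^sub>1\<rangle>\<close> does not depend on \<open>\<theta>\<^sub>2\<close>, nor \<open>F\<^sub>2\<close> on
  \<open>\<theta>\<^sub>1\<close>, nor \<open>G\<close> on either angle. If \<open>F\<^sub>1\<close> and \<open>\<partial>F\<^sub>1/\<partial>\<theta>\<^sub>1\<close> both vanish, then \<open>c\<close> is orthogonal
  to the normal plane at \<open>s\<^sub>1\<close>, so the pair is \<open>s\<^sub>1\<close>-special (\<open>height_eq_0_imp_tangent\<close>). Hence at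
  pairs that are not special the two angular derivatives separate all three gradients. At an
  \<open>s\<^sub>1\<close>-special pair \<open>G\<close> is not active, because \<open>\<delta>\<close> is admissible; the pair is not
  \<open>s\<^sub>2\<close>-special, because the two tangent lines would coincide, hence \<open>\<partial>F\<^sub>2/\<partial>\<theta>\<^sub>2 \<noteq> 0\<close> if \<open>F\<^sub>2 = 0\<close>,
  so the \<open>\<theta>\<^sub>2\<close>-components separate \<open>F\<^sub>2\<close> from \<open>F\<^sub>1\<close>; and the gradient of \<open>F\<^sub>1\<close> does not vanish
  (\<open>tangent_chord_nondegenerate\<close>): its \<open>s\<^sub>1\<close>-component is a
  nonzero multiple of \<open>\<kappa> cos \<theta>\<^sub>1\<close>, and where the cosine is zero, \<open>v\<^sub>1 = \<plusminus>b(s\<^sub>1)\<close> and the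
  \<open>s\<^sub>2\<close>-component \<open>\<langle>\<gamma>'(s\<^sub>2), v\<^sub>1\<rangle>\<close> is nonzero because the tangent line at \<open>s\<^sub>2\<close> leaves the osculating
  plane at \<open>s\<^sub>1\<close>. The \<open>s\<^sub>2\<close>-special pairs are symmetric, since \<open>F\<^sub>2\<close> is \<open>-F\<^sub>1\<close> with the endpoints
  exchanged.

  Independence of the active gradients persists near the point and for small \<open>\<epsilon>\<close>
  (\<open>transverse_inequalities_stable\<close>), and by compactness one bound on \<open>\<epsilon>\<close> serves all points
  (\<open>thin_tube_corner_points\<close>). The active constraints, completed by linear functions to a map with
  invertible derivative, are then local coordinates by the inverse function theorem
  (\<open>smooth_inverse_function\<close>), and they carry the set to a piece of a sector. The covering of the
  space of chords by \<open>\<real>\<^sup>4\<close> transports these coordinates to charts; two lifts of a chart differ by a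
  translation, which makes the transition maps smooth (\<open>is_manifold_with_corners_in_quotient\<close>).
\<close>

section \<open>Rules of calculus for smooth maps\<close>

text \<open>On an open set the derivatives are determined by the values on the set itself.\<close>

lemma Ck_on_cong:
  assumes "open S" "\<And>x. x \<in> S \<Longrightarrow> f x = g x" "Ck_on k S f"
  shows "Ck_on k S g"
  using assms(2,3)
proof (induction k arbitrary: f g)
  case 0
  then show ?case using continuous_on_cong[of S S f g] by simp
next
  case (Suc k)
  have deriv: "(g has_derivative frechet_derivative f (at x)) (at x)" if "x \<in> S" for x
  proof (rule has_derivative_transform_within_open)
    show "(f has_derivative frechet_derivative f (at x)) (at x)"
      using Suc.prems(2) that by (simp add: frechet_derivative_works[symmetric])
  qed (use assms(1) that Suc.prems(1) in auto)
  have "Ck_on k S (\<lambda>x. frechet_derivative g (at x) v)" for v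
  proof (rule Suc.IH)
    show "frechet_derivative f (at x) v = frechet_derivative g (at x) v" if "x \<in> S" for x
      using frechet_derivative_at[OF deriv[OF that]] by simp
  qed (use Suc.prems in simp)
  then show ?case
    using deriv by (auto simp: differentiable_def)
qed

text \<open>The working rule for the inductions on \<open>k\<close>: any explicit formula for the derivative may
  replace \<^const>\<open>frechet_derivative\<close>.\<close>

lemma Ck_on_Suc_derivI:
  assumes "open S" "\<And>x. x \<in> S \<Longrightarrow> (f has_derivative f' x) (at x)"
    and "\<And>v. Ck_on k S (\<lambda>x. f' x v)"
  shows "Ck_on (Suc k) S f"
proof -
  have "Ck_on k S (\<lambda>x. frechet_derivative f (at x) v)" for v
  proof (rule Ck_on_cong[OF assms(1) _ assms(3)])
    show "f' x v = frechet_derivative f (at x) v" if "x \<in> S" for x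
      using frechet_derivative_at[OF assms(2)[OF that]] by simp
  qed
  then show ?thesis
    using assms(2) by (auto simp: differentiable_def)
qed

lemma Ck_on_Suc_has_derivative:
  assumes "Ck_on (Suc k) S f" "x \<in> S"
  shows "(f has_derivative frechet_derivative f (at x)) (at x)"
  using assms by (simp add: frechet_derivative_works[symmetric])

lemma Ck_on_subset: "Ck_on k S f \<Longrightarrow> R \<subseteq> S \<Longrightarrow> Ck_on k R f"
  by (induction k arbitrary: f) (auto intro: continuous_on_subset)

lemma Ck_on_Suc_imp_Ck_on: "Ck_on (Suc k) S f \<Longrightarrow> Ck_on k S f"
proof (induction k arbitrary: f)
  case 0
  then show ?case
    by (simp add: continuous_at_imp_continuous_on differentiable_imp_continuous_within)
next
  case (Suc k)
  then have "\<forall>v. Ck_on k S (\<lambda>x. frechet_derivative f (at x) v)"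
    by (metis Ck_on.simps(2))
  with Suc.prems show ?case by simp
qed

lemma Ck_on_const: "open S \<Longrightarrow> Ck_on k S (\<lambda>x. c)"
proof (induction k arbitrary: c)
  case (Suc k)
  show ?case
    by (rule Ck_on_Suc_derivI[where f' = "\<lambda>_ _. 0"]) (use Suc in auto)
qed auto

lemma Ck_on_bounded_linear:
  assumes "open S" "bounded_linear f"
  shows "Ck_on k S f"
proof (cases k)
  case 0
  then show ?thesis using assms by (simp add: linear_continuous_on)
next
  case (Suc m)
  show ?thesis unfolding Suc
    by (rule Ck_on_Suc_derivI[where f' = "\<lambda>_. f"])
       (use assms Ck_on_const in \<open>auto simp: bounded_linear_imp_has_derivative\<close>)
qed

lemma Ck_on_bounded_linear_comp:
  assumes "open S" "bounded_linear l" "Ck_on k S f"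
  shows "Ck_on k S (\<lambda>x. l (f x))"
  using assms(3)
proof (induction k arbitrary: f)
  case 0
  then show ?case using assms by (auto intro: bounded_linear.continuous_on)
next
  case (Suc k)
  show ?case
    by (rule Ck_on_Suc_derivI[OF assms(1) bounded_linear.has_derivative[OF assms(2)
            Ck_on_Suc_has_derivative[OF Suc.prems]]])
       (use Suc in auto)
qed

lemma Ck_on_add:
  assumes "open S" "Ck_on k S f" "Ck_on k S g"
  shows "Ck_on k S (\<lambda>x. f x + g x)"
  using assms(2,3)
proof (induction k arbitrary: f g)
  case 0
  then show ?case by (simp add: continuous_on_add)
next
  case (Suc k)
  show ?case
    by (rule Ck_on_Suc_derivI[OF assms(1) has_derivative_add[OF
            Ck_on_Suc_has_derivative[OF Suc.prems(1)] Ck_on_Suc_has_derivative[OF Suc.prems(2)]]])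
       (use Suc in auto)
qed

lemma Ck_on_bilinear:
  assumes "open S" "bounded_bilinear pr" "Ck_on k S f" "Ck_on k S g"
  shows "Ck_on k S (\<lambda>x. pr (f x) (g x))"
  using assms(3,4)
proof (induction k arbitrary: f g)
  case 0
  then show ?case using assms by (auto intro: bounded_bilinear.continuous_on)
next
  case (Suc k)
  show ?case
  proof (rule Ck_on_Suc_derivI[OF assms(1) bounded_bilinear.FDERIV[OF assms(2)
            Ck_on_Suc_has_derivative[OF Suc.prems(1)] Ck_on_Suc_has_derivative[OF Suc.prems(2)]]])
    fix v
    show "Ck_on k S (\<lambda>x. pr (f x) (frechet_derivative g (at x) v) + pr (frechet_derivative f (at x) v) (g x))"
      using Suc.prems Suc.prems[THEN Ck_on_Suc_imp_Ck_on]
      by (intro Ck_on_add Suc.IH assms(1)) simp_all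
  qed auto
qed

lemmas Ck_on_mult = Ck_on_bilinear[OF _ bounded_bilinear_mult]
  and Ck_on_scaleR = Ck_on_bilinear[OF _ bounded_bilinear_scaleR]

lemma Ck_on_sum:
  assumes "open S" "\<And>i. i \<in> I \<Longrightarrow> Ck_on k S (f i)"
  shows "Ck_on k S (\<lambda>x. \<Sum>i\<in>I. f i x)"
  using assms(2)
  by (induction I rule: infinite_finite_induct)
     (simp_all add: Ck_on_const Ck_on_add assms(1))

lemma Ck_on_prod:
  fixes f :: "'i \<Rightarrow> 'a::euclidean_space \<Rightarrow> real"
  assumes "open S" "\<And>i. i \<in> I \<Longrightarrow> Ck_on k S (f i)"
  shows "Ck_on k S (\<lambda>x. \<Prod>i\<in>I. f i x)"
  using assms(2)
  by (induction I rule: infinite_finite_induct)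
     (simp_all add: Ck_on_const Ck_on_mult assms(1))

text \<open>Expanding the inner derivative in the standard basis turns the chain rule into a sum of
  products of maps that are \<open>k\<close> times continuously differentiable by induction.\<close>

lemma Ck_on_compose:
  assumes "open S" "open R" "f ` S \<subseteq> R" "Ck_on k S f" "Ck_on k R g"
  shows "Ck_on k S (\<lambda>x. g (f x))"
  using assms(3-5)
proof (induction k arbitrary: f g)
  case 0
  then show ?case by (auto intro: continuous_on_compose2)
next
  case (Suc k)
  note df = Ck_on_Suc_has_derivative[OF Suc.prems(2)]
  have dg: "(g has_derivative frechet_derivative g (at (f x))) (at (f x))" if "x \<in> S" for x
    using Ck_on_Suc_has_derivative[OF Suc.prems(3)] Suc.prems(1) that by blast
  show ?case
  proof (rule Ck_on_Suc_derivI[OF assms(1) has_derivative_compose[OF df dg]])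
    fix v
    have "Ck_on k S (\<lambda>x. frechet_derivative f (at x) v)"
      using Suc.prems(2) by simp
    moreover have "Ck_on k S (\<lambda>x. frechet_derivative g (at (f x)) b)" for b
      using Suc.IH[of f "\<lambda>y. frechet_derivative g (at y) b", OF Suc.prems(1) Ck_on_Suc_imp_Ck_on[OF Suc.prems(2)]]
        Suc.prems(3) by simp
    ultimately have "Ck_on k S (\<lambda>x. \<Sum>b\<in>Basis. (frechet_derivative f (at x) v \<bullet> b) *\<^sub>R frechet_derivative g (at (f x)) b)"
      by (intro Ck_on_sum Ck_on_scaleR Ck_on_bilinear[OF _ bounded_bilinear_inner] Ck_on_const assms(1))
    then show "Ck_on k S (\<lambda>x. frechet_derivative g (at (f x)) (frechet_derivative f (at x) v))"
    proof (rule Ck_on_cong[OF assms(1), rotated])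
      fix x assume "x \<in> S"
      then have "linear (frechet_derivative g (at (f x)))"
        using dg has_derivative_linear by blast
      then show "(\<Sum>b\<in>Basis. (frechet_derivative f (at x) v \<bullet> b) *\<^sub>R frechet_derivative g (at (f x)) b) =
          frechet_derivative g (at (f x)) (frechet_derivative f (at x) v)"
        using linear_sum[of "frechet_derivative g (at (f x))" "\<lambda>b. (frechet_derivative f (at x) v \<bullet> b) *\<^sub>R b" Basis]
        by (simp add: linear_scale euclidean_representation)
    qed
  qed auto
qed

text \<open>The derivative is a product of copies of the function itself, so the induction closes.\<close>

lemma Ck_on_inverse: "Ck_on k (- {0}) (inverse :: real \<Rightarrow> real)"
proof (induction k)
  case 0
  then show ?case by (auto intro!: continuous_intros)
next
  case (Suc k)
  have op: "open (- {0::real})" by auto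
  show ?case
  proof (rule Ck_on_Suc_derivI[OF op])
    fix x :: real assume "x \<in> - {0}"
    then show "(inverse has_derivative (\<lambda>v. - (inverse x * v * inverse x))) (at x)"
      by (intro has_derivative_inverse') auto
  next
    fix v :: real
    have "Ck_on k (- {0}) (\<lambda>x::real. inverse x * (- v) * inverse x)"
      by (intro Ck_on_mult op Suc Ck_on_const)
    then show "Ck_on k (- {0}) (\<lambda>x::real. - (inverse x * v * inverse x))" by simp
  qed
qed

lemma Ck_on_sqrt: "Ck_on k {0<..} sqrt"
proof (induction k)
  case 0
  then show ?case by (auto intro!: continuous_intros)
next
  case (Suc k)
  have op: "open {0::real<..}" by auto
  show ?case
  proof (rule Ck_on_Suc_derivI[OF op])
    fix x :: real assume "x \<in> {0<..}"
    then have "(sqrt has_derivative (*) (inverse (sqrt x) / 2)) (at x)"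
      using DERIV_real_sqrt[of x] by (simp add: has_field_derivative_def)
    moreover have "(*) (inverse (sqrt x) / 2) = (\<lambda>v. inverse (sqrt x) * (v / 2))"
      by auto
    ultimately show "(sqrt has_derivative (\<lambda>v. inverse (sqrt x) * (v / 2))) (at x)"
      by simp
  next
    fix v :: real
    show "Ck_on k {0<..} (\<lambda>x. inverse (sqrt x) * (v / 2))"
      by (rule Ck_on_mult[OF op Ck_on_compose[OF op _ _ Suc Ck_on_inverse] Ck_on_const[OF op]]) auto
  qed
qed

lemma Ck_on_sin_cos: "Ck_on k UNIV (sin :: real \<Rightarrow> real) \<and> Ck_on k UNIV (cos :: real \<Rightarrow> real)"
proof (induction k)
  case 0
  then show ?case by (auto intro!: continuous_intros)
next
  case (Suc k)
  have "Ck_on (Suc k) UNIV (sin :: real \<Rightarrow> real)"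
  proof (rule Ck_on_Suc_derivI)
    show "((sin :: real \<Rightarrow> real) has_derivative (\<lambda>v. cos x * v)) (at x)" for x
      using DERIV_sin[of x] by (simp add: has_field_derivative_def)
    show "Ck_on k UNIV (\<lambda>x. cos x * (v::real))" for v
      using Suc by (intro Ck_on_mult Ck_on_const) auto
  qed auto
  moreover have "Ck_on (Suc k) UNIV (cos :: real \<Rightarrow> real)"
  proof (rule Ck_on_Suc_derivI)
    show "((cos :: real \<Rightarrow> real) has_derivative (\<lambda>v. sin x * (- v))) (at x)" for x
      by (auto intro!: derivative_eq_intros)
    show "Ck_on k UNIV (\<lambda>x. sin x * (- v::real))" for v
      using Suc by (intro Ck_on_mult Ck_on_const) auto
  qed auto
  ultimately show ?case by simp
qed

lemma Ck_on_vec_nth: "open S \<Longrightarrow> Ck_on k S f \<Longrightarrow> Ck_on k S (\<lambda>x. f x $ i)"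
  by (rule Ck_on_bounded_linear_comp[OF _ bounded_linear_vec_nth])

lemma Ck_on_vec_lambda:
  fixes f :: "'n::finite \<Rightarrow> 'a::euclidean_space \<Rightarrow> real"
  assumes "open S" "\<And>i. Ck_on k S (f i)"
  shows "Ck_on k S (\<lambda>x. \<chi> i. f i x)"
proof -
  have "Ck_on k S (\<lambda>x. \<Sum>i\<in>UNIV. f i x *\<^sub>R axis i (1::real))"
    by (intro Ck_on_sum Ck_on_scaleR Ck_on_const assms)
  moreover have "(\<Sum>i\<in>UNIV. f i x *\<^sub>R axis i (1::real)) = (\<chi> i. f i x)" for x
    by (simp add: vec_eq_iff axis_def if_distrib[of "(*) _"] cong: if_cong)
  ultimately show ?thesis by simp
qed

lemma Ck_on_det:
  fixes M :: "'a::euclidean_space \<Rightarrow> real ^ 'n ^ 'n"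
  assumes "open S" "\<And>i j. Ck_on k S (\<lambda>x. M x $ i $ j)"
  shows "Ck_on k S (\<lambda>x. det (M x))"
  unfolding det_def
  by (intro Ck_on_sum Ck_on_mult Ck_on_const Ck_on_prod assms)

named_theorems smooth_intros

lemma smooth_on_const [smooth_intros]: "open S \<Longrightarrow> smooth_on S (\<lambda>x. c)"
  by (simp add: smooth_on_def Ck_on_const)

lemma smooth_on_bounded_linear: "open S \<Longrightarrow> bounded_linear f \<Longrightarrow> smooth_on S f"
  by (simp add: smooth_on_def Ck_on_bounded_linear)

lemma smooth_on_id [smooth_intros]: "open S \<Longrightarrow> smooth_on S (\<lambda>x. x)"
  by (rule smooth_on_bounded_linear[OF _ bounded_linear_ident])

lemma smooth_on_bilinear:
  "open S \<Longrightarrow> bounded_bilinear pr \<Longrightarrow> smooth_on S f \<Longrightarrow> smooth_on S g \<Longrightarrow> smooth_on S (\<lambda>x. pr (f x) (g x))"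
  unfolding smooth_on_def by (intro allI Ck_on_bilinear[of S pr]) simp_all

lemmas smooth_on_mult [smooth_intros] = smooth_on_bilinear[OF _ bounded_bilinear_mult]
  and smooth_on_scaleR [smooth_intros] = smooth_on_bilinear[OF _ bounded_bilinear_scaleR]
  and smooth_on_inner [smooth_intros] = smooth_on_bilinear[OF _ bounded_bilinear_inner]

lemma smooth_on_cross3 [smooth_intros]:
  "open S \<Longrightarrow> smooth_on S f \<Longrightarrow> smooth_on S g \<Longrightarrow> smooth_on S (\<lambda>x. cross3 (f x) (g x))"
  by (rule smooth_on_bilinear[OF _ bilinear_cross[unfolded bilinear_conv_bounded_bilinear]])

lemma smooth_on_add [smooth_intros]:
  "open S \<Longrightarrow> smooth_on S f \<Longrightarrow> smooth_on S g \<Longrightarrow> smooth_on S (\<lambda>x. f x + g x)"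
  unfolding smooth_on_def by (intro allI Ck_on_add) simp_all

lemma smooth_on_minus [smooth_intros]:
  "open S \<Longrightarrow> smooth_on S f \<Longrightarrow> smooth_on S (\<lambda>x. - f x)"
  unfolding smooth_on_def
  by (intro allI Ck_on_bounded_linear_comp[OF _ bounded_linear_minus[OF bounded_linear_ident]]) simp_all

lemma smooth_on_diff [smooth_intros]:
  "open S \<Longrightarrow> smooth_on S f \<Longrightarrow> smooth_on S g \<Longrightarrow> smooth_on S (\<lambda>x. f x - g x)"
  unfolding diff_conv_add_uminus by (intro smooth_on_add smooth_on_minus)

lemma smooth_on_vec_nth [smooth_intros]: "open S \<Longrightarrow> smooth_on S f \<Longrightarrow> smooth_on S (\<lambda>x. f x $ i)"
  unfolding smooth_on_def by (intro allI Ck_on_vec_nth) simp_all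

lemma smooth_on_vec_lambda [smooth_intros]:
  fixes f :: "'n::finite \<Rightarrow> 'a::euclidean_space \<Rightarrow> real"
  shows "open S \<Longrightarrow> (\<And>i. smooth_on S (f i)) \<Longrightarrow> smooth_on S (\<lambda>x. \<chi> i. f i x)"
  unfolding smooth_on_def by (rule allI, rule Ck_on_vec_lambda, assumption, blast)

lemma smooth_on_cong:
  "open S \<Longrightarrow> smooth_on S f \<Longrightarrow> (\<And>x. x \<in> S \<Longrightarrow> f x = g x) \<Longrightarrow> smooth_on S g"
  unfolding smooth_on_def by (metis Ck_on_cong)

lemma smooth_on_subset: "smooth_on S f \<Longrightarrow> R \<subseteq> S \<Longrightarrow> smooth_on R f"
  unfolding smooth_on_def using Ck_on_subset by blast

lemma smooth_on_compose:
  "open S \<Longrightarrow> open R \<Longrightarrow> f ` S \<subseteq> R \<Longrightarrow> smooth_on S f \<Longrightarrow> smooth_on R g \<Longrightarrow> smooth_on S (\<lambda>x. g (f x))"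
  unfolding smooth_on_def by (rule allI, rule Ck_on_compose[where f = f and g = g and R = R]) simp_all

lemma smooth_on_compose_UNIV:
  "open S \<Longrightarrow> smooth_on UNIV g \<Longrightarrow> smooth_on S f \<Longrightarrow> smooth_on S (\<lambda>x. g (f x))"
  by (rule smooth_on_compose[where R = UNIV]) auto

lemma smooth_on_sin [smooth_intros]: "open S \<Longrightarrow> smooth_on S f \<Longrightarrow> smooth_on S (\<lambda>x. sin (f x :: real))"
  and smooth_on_cos [smooth_intros]: "open S \<Longrightarrow> smooth_on S f \<Longrightarrow> smooth_on S (\<lambda>x. cos (f x :: real))"
  by (rule smooth_on_compose_UNIV; simp add: smooth_on_def Ck_on_sin_cos)+

lemma smooth_on_inverse:
  fixes f :: "'a::euclidean_space \<Rightarrow> real"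
  assumes "open S" "smooth_on S f" "\<And>x. x \<in> S \<Longrightarrow> f x \<noteq> 0"
  shows "smooth_on S (\<lambda>x. inverse (f x))"
  by (rule smooth_on_compose[where R = "- {0}"])
     (use assms in \<open>auto simp: smooth_on_def Ck_on_inverse open_Compl\<close>)

lemma smooth_on_norm:
  fixes f :: "'a::euclidean_space \<Rightarrow> 'b::euclidean_space"
  assumes "open S" "smooth_on S f" "\<And>x. x \<in> S \<Longrightarrow> f x \<noteq> 0"
  shows "smooth_on S (\<lambda>x. norm (f x))"
proof -
  have "smooth_on S (\<lambda>x. sqrt (f x \<bullet> f x))"
    by (rule smooth_on_compose[where R = "{0<..}"])
       (use assms in \<open>simp_all add: smooth_on_inner image_subset_iff\<close>, simp add: smooth_on_def Ck_on_sqrt)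
  then show ?thesis by (simp add: norm_eq_sqrt_inner)
qed

lemma smooth_on_has_derivative:
  "smooth_on S f \<Longrightarrow> x \<in> S \<Longrightarrow> (f has_derivative frechet_derivative f (at x)) (at x)"
  unfolding smooth_on_def using Ck_on_Suc_has_derivative by blast

lemma smooth_on_imp_continuous_on: "smooth_on S f \<Longrightarrow> continuous_on S f"
  unfolding smooth_on_def by (metis Ck_on.simps(1))

lemma smooth_on_frechet_derivative:
  "smooth_on S f \<Longrightarrow> smooth_on S (\<lambda>x. frechet_derivative f (at x) v)"
  unfolding smooth_on_def by (metis Ck_on.simps(2))

lemma smooth_on_vector_derivative:
  fixes f :: "real \<Rightarrow> 'b::real_normed_vector"
  assumes "open S" "smooth_on S f"
  shows "smooth_on S (\<lambda>t. vector_derivative f (at t))"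
proof (rule smooth_on_cong[OF assms(1) smooth_on_frechet_derivative[OF assms(2), of 1]])
  fix x assume "x \<in> S"
  then have "f differentiable (at x)"
    using smooth_on_has_derivative[OF assms(2)] differentiableI by blast
  then show "frechet_derivative f (at x) 1 = vector_derivative f (at x)"
    by (simp add: frechet_derivative_eq_vector_derivative)
qed

section \<open>The inverse function theorem for smooth maps\<close>

definition jac :: "(real ^ 'n \<Rightarrow> real ^ 'm) \<Rightarrow> real ^ 'n \<Rightarrow> real ^ 'n ^ 'm" where
  "jac f x = matrix (frechet_derivative f (at x))"

lemma jac_mult_vector:
  assumes "smooth_on S f" "x \<in> S"
  shows "jac f x *v v = frechet_derivative f (at x) v"
proof -
  have "linear (frechet_derivative f (at x))"
    using smooth_on_has_derivative[OF assms] has_derivative_linear by blast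
  then show ?thesis
    unfolding jac_def by (metis matrix_vector_mul(2))
qed

lemma smooth_on_jac: "open S \<Longrightarrow> smooth_on S f \<Longrightarrow> smooth_on S (\<lambda>x. jac f x $ i $ j)"
  unfolding jac_def matrix_def
  by (simp, intro smooth_on_vec_nth smooth_on_frechet_derivative)

lemma smooth_on_det_jac:
  fixes f :: "real ^ 'n \<Rightarrow> real ^ 'n"
  assumes "open S" "smooth_on S f"
  shows "smooth_on S (\<lambda>x. det (jac f x))"
  using smooth_on_jac[OF assms] unfolding smooth_on_def
  by (intro allI Ck_on_det assms(1)) simp

text \<open>Bootstrapping: by Cramer's rule the derivative of the inverse \<open>g\<close> at \<open>y\<close> is a rational
  expression in the entries of the Jacobian of \<open>f\<close> at \<open>g y\<close>, so it is as smooth as \<open>g\<close>.\<close>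

lemma Ck_on_local_inverse:
  fixes f g :: "real ^ 'n \<Rightarrow> real ^ 'n"
  assumes "open U" "open V" "smooth_on U f" "g ` V \<subseteq> U" "continuous_on V g"
    and inv: "\<And>x. x \<in> U \<Longrightarrow> det (jac f x) \<noteq> 0"
    and deriv: "\<And>y. y \<in> V \<Longrightarrow> (g has_derivative g' y) (at y)"
    and g': "\<And>y v. y \<in> V \<Longrightarrow> frechet_derivative f (at (g y)) (g' y v) = v"
  shows "Ck_on k V g"
proof (induction k)
  case 0
  then show ?case using assms(5) by simp
next
  case (Suc k)
  let ?A = "\<lambda>y. jac f (g y)"
  let ?num = "\<lambda>y v j. det (\<chi> i l. if l = j then v $ i else ?A y $ i $ l)"
  have gU: "g y \<in> U" if "y \<in> V" for y using assms(4) that by blast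
  have entry: "Ck_on k V (\<lambda>y. ?A y $ i $ j)" for i j
  proof -
    have "Ck_on k U (\<lambda>x. jac f x $ i $ j)"
      using smooth_on_jac[OF assms(1,3)] unfolding smooth_on_def by blast
    then show ?thesis
      by (rule Ck_on_compose[OF assms(2,1,4) Suc])
  qed
  have eq: "g' y v = (\<chi> j. ?num y v j * inverse (det (?A y)))" if "y \<in> V" for y v
  proof -
    have "?A y *v g' y v = v"
      using jac_mult_vector[OF assms(3) gU[OF that]] g'[OF that] by simp
    then have "g' y v = (\<chi> j. ?num y v j / det (?A y))"
      by (rule iffD1[OF cramer[OF inv[OF gU[OF that]]]])
    then show ?thesis by (simp add: divide_inverse)
  qed
  show ?case
  proof (rule Ck_on_Suc_derivI[OF assms(2) deriv])
    fix v
    have "Ck_on k V (\<lambda>y. inverse (det (?A y)))"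
    proof (rule Ck_on_compose[where R = "- {0}" and g = inverse])
      show "Ck_on k V (\<lambda>y. det (?A y))"
        by (rule Ck_on_det[OF assms(2) entry])
    qed (use assms(2) inv gU Ck_on_inverse in \<open>auto simp: open_Compl\<close>)
    moreover have "Ck_on k V (\<lambda>y. ?num y v j)" for j
    proof (rule Ck_on_det[OF assms(2)])
      fix i l
      show "Ck_on k V (\<lambda>y. (\<chi> i l. if l = j then v $ i else ?A y $ i $ l) $ i $ l)"
        by (cases "l = j") (simp_all add: entry Ck_on_const assms(2))
    qed
    ultimately have "Ck_on k V (\<lambda>y. \<chi> j. ?num y v j * inverse (det (?A y)))"
      by (intro Ck_on_vec_lambda Ck_on_mult assms(2))
    then show "Ck_on k V (\<lambda>y. g' y v)"
      by (rule Ck_on_cong[OF assms(2), rotated]) (simp add: eq)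
  qed
qed

text \<open>The inverse function theorem for continuously differentiable maps yields the local
  homeomorphism; smoothness of the inverse then comes from the bootstrapping above.\<close>

theorem smooth_inverse_function:
  fixes f :: "real ^ 'n \<Rightarrow> real ^ 'n"
  assumes "open U" "smooth_on U f" "x \<in> U" "det (jac f x) \<noteq> 0"
  obtains U' V g where "open U'" "U' \<subseteq> U" "x \<in> U'" "open V" "homeomorphism U' V f g" "smooth_on V g"
proof -
  define U1 where "U1 = {y \<in> U. det (jac f y) \<noteq> 0}"
  have "open {y \<in> U. (\<lambda>y. det (jac f y)) y \<in> - {0}}"
    using smooth_on_imp_continuous_on[OF smooth_on_det_jac[OF assms(1,2)]] assms(1)
    by (intro continuous_open_preimage[unfolded vimage_def Int_def, simplified]) auto
  then have U1: "open U1" "U1 \<subseteq> U" "x \<in> U1"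
    using assms(3,4) by (auto simp: U1_def)
  have smooth: "smooth_on U1 f"
    using smooth_on_subset[OF assms(2) U1(2)] .
  let ?D = "\<lambda>y. Blinfun (frechet_derivative f (at y))"
  have D: "blinfun_apply (?D y) = frechet_derivative f (at y)" if "y \<in> U1" for y
    using smooth_on_has_derivative[OF smooth that] has_derivative_bounded_linear
    by (intro bounded_linear_Blinfun_apply) blast
  obtain B where B: "B ** jac f x = mat 1"
    using assms(4) invertible_det_nz[of "jac f x"] by (auto simp: invertible_def)
  have *: "Blinfun ((*v) B) o\<^sub>L ?D x = id_blinfun"
  proof (rule blinfun_eqI)
    fix v
    have "B *v (jac f x *v v) = v"
      by (simp add: matrix_vector_mul_assoc B)
    then show "blinfun_apply (Blinfun ((*v) B) o\<^sub>L ?D x) v = blinfun_apply id_blinfun v"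
      using jac_mult_vector[OF smooth U1(3)] D[OF U1(3)]
      by (simp add: bounded_linear_Blinfun_apply)
  qed
  obtain U' V g g' where *: "open U'" "U' \<subseteq> U1" "x \<in> U'" "open V" "homeomorphism U' V f g"
    and g': "\<And>y. y \<in> V \<Longrightarrow> (g has_derivative (g' y)) (at y)"
      "\<And>y. y \<in> V \<Longrightarrow> g' y = inv (blinfun_apply (?D (g y)))"
      "\<And>y. y \<in> V \<Longrightarrow> bij (blinfun_apply (?D (g y)))"
  proof (rule inverse_function_theorem[of U1 f ?D x "Blinfun ((*v) B)"])
    show "continuous_on U1 ?D"
    proof (rule continuous_on_blinfun_componentwise)
      fix i :: "real ^ 'n"
      show "continuous_on U1 (\<lambda>y. blinfun_apply (?D y) i)"
        using smooth_on_imp_continuous_on[OF smooth_on_frechet_derivative[OF smooth, of i]]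
        by (rule continuous_on_eq) (simp add: D)
    qed
  qed (use U1 smooth D * smooth_on_has_derivative[OF smooth] in auto)
  have gV: "g y \<in> U'" if "y \<in> V" for y
    using *(5) that by (auto simp: homeomorphism_def)
  have "Ck_on k V g" for k
  proof (rule Ck_on_local_inverse[OF U1(1) *(4) smooth _ _ _ g'(1)])
    fix y v assume "y \<in> V"
    then show "frechet_derivative f (at (g y)) (g' y v) = v"
      using g'(2,3)[of y] D[of "g y"] gV *(2) by (metis bij_inv_eq_iff subsetD)
  qed (use *(2,5) gV in \<open>auto simp: U1_def homeomorphism_def\<close>)
  then show ?thesis
    using that[OF *(1) _ *(3,4,5)] *(2) U1(2) by (auto simp: smooth_on_def)
qed

section \<open>Manifolds with corners in a quotient of Euclidean space by translations\<close>

text \<open>The condition on a chart in a form that is easy to verify: only a determinant at one point has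
  to be computed, and the inverse function theorem supplies the chart. Coordinates outside \<open>I\<close> are
  unconstrained, so \<open>x\<close> may also be an interior point of \<open>S\<close>.\<close>

definition corner_point :: "(real ^ 'n) set \<Rightarrow> real ^ 'n \<Rightarrow> bool" where
  "corner_point S x \<longleftrightarrow>
     (\<exists>U f I. open U \<and> x \<in> U \<and> smooth_on U f \<and> det (jac f x) \<noteq> 0 \<and>
        S \<inter> U = {y \<in> U. f y \<in> sector I})"

lemma corner_point_local:
  assumes "corner_point S x" "open B" "x \<in> B" "S \<inter> B = S' \<inter> B"
  shows "corner_point S' x"
proof -
  obtain U f I where *: "open U" "x \<in> U" "smooth_on U f" "det (jac f x) \<noteq> 0"
      "S \<inter> U = {y \<in> U. f y \<in> sector I}"
    using assms(1) unfolding corner_point_def by (elim exE conjE)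
  show ?thesis
    unfolding corner_point_def
    by (rule exI[of _ "U \<inter> B"], rule exI[of _ f], rule exI[of _ I])
       (use * assms in \<open>auto intro: smooth_on_subset\<close>)
qed

lemma corner_point_diffeomorphism:
  fixes S :: "(real ^ 'n) set"
  assumes "corner_point S x" "open W" "x \<in> W"
  obtains U V I and f g :: "real ^ 'n \<Rightarrow> real ^ 'n" where "open U" "x \<in> U" "U \<subseteq> W" "open V" "homeomorphism U V f g"
    "smooth_on U f" "smooth_on V g" "S \<inter> U = {y \<in> U. f y \<in> sector I}"
proof -
  obtain U f I where *: "open U" "x \<in> U" "smooth_on U f" "det (jac f x) \<noteq> 0"
      "S \<inter> U = {y \<in> U. f y \<in> sector I}"
    using assms(1) unfolding corner_point_def by (elim exE conjE)
  have "open (U \<inter> W)" "smooth_on (U \<inter> W) f" "x \<in> U \<inter> W"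
    using * assms by (auto intro: smooth_on_subset)
  then obtain U' V g where U': "open U'" "U' \<subseteq> U \<inter> W" "x \<in> U'" "open V" "homeomorphism U' V f g" "smooth_on V g"
    using *(4) by (rule smooth_inverse_function)
  have "smooth_on U' f" using smooth_on_subset[OF *(3)] U'(2) by blast
  moreover have "S \<inter> U' = {y \<in> U'. f y \<in> sector I}"
    using *(5) U'(2) by blast
  ultimately show ?thesis
    by (intro that[OF U'(1,3) _ U'(4,5) _ U'(6)]) (use U'(2) in auto)
qed

text \<open>The quotients of \<open>\<real>\<^sup>n\<close> by a discrete group of translations, without naming the group: by the
  assumption \<open>translation\<close>, the vector between two points of a fibre translates every fibre to itself.\<close>

locale translation_quotient =
  fixes \<pi> :: "real ^ 'n \<Rightarrow> 'a" and Q :: "'a topology"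
  assumes cont: "continuous_map euclidean Q \<pi>"
    and open_map: "open_map euclidean Q \<pi>"
    and onto: "range \<pi> = topspace Q"
    and locally_inj: "\<And>x. \<exists>U. open U \<and> x \<in> U \<and> inj_on \<pi> U"
    and translation: "\<And>x y z. \<pi> x = \<pi> y \<Longrightarrow> \<pi> (z + (y - x)) = \<pi> z"
    and Hausdorff: "Hausdorff_space Q"
begin

text \<open>With \<open>S = \<pi> -` X\<close> these are charts of the subset \<open>X\<close> of the quotient, with \<open>S = UNIV\<close> charts of
  the quotient, so that one lemma covers both kinds of transition maps.\<close>

definition lifted_chart :: "(real ^ 'n) set \<Rightarrow> (real ^ 'n) set \<Rightarrow> (real ^ 'n \<Rightarrow> real ^ 'n) \<Rightarrow> ('a, 'n) chart" where
  "lifted_chart U S f = (\<pi> ` (U \<inter> S), f \<circ> inv_into U \<pi>)"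

text \<open>If \<open>x\<close> and \<open>x'\<close> are lifts of a common point of the two domains, then near it the two local
  sections of \<open>\<pi>\<close> differ by the translation by \<open>x' - x\<close>. The transition map is therefore
  \<open>y \<mapsto> f' (g y + (x' - x))\<close> there.\<close>

lemma smooth_transition_lifted_chart:
  assumes "open V" "homeomorphism U V f g" "smooth_on V g" "inj_on \<pi> U"
    and "open U'" "smooth_on U' f'" "inj_on \<pi> U'"
  shows "smooth_transition (lifted_chart U S f) (lifted_chart U' S' f')"
  unfolding smooth_transition_def smooth_map_on_def
proof
  let ?c = "lifted_chart U S f" and ?d = "lifted_chart U' S' f'"
  fix y assume "y \<in> snd ?c ` (fst ?c \<inter> fst ?d)"
  then obtain x x' where x: "x \<in> U" "y = f (inv_into U \<pi> (\<pi> x))" and x': "x' \<in> U'" "\<pi> x' = \<pi> x"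
    by (auto simp: lifted_chart_def)
  then have x: "x \<in> U" "y = f x"
    using assms(4) by (simp_all add: inv_into_f_f)
  have gf: "g (f z) = z" if "z \<in> U" for z
    using assms(2) that by (simp add: homeomorphism_def)
  define t where "t = x' - x"
  \<comment> \<open>On \<open>W\<close> the lift by \<open>g\<close>, moved by \<open>t\<close>, stays in the sheet of the second chart.\<close>
  define W where "W = {y \<in> V. g y + t \<in> U'}"
  have "continuous_on V (\<lambda>y. g y + t)"
    using assms(2) by (intro continuous_intros) (simp add: homeomorphism_def)
  then have "open W"
    unfolding W_def
    using continuous_open_preimage[OF _ assms(1,5)] by (simp add: vimage_def Int_def)
  moreover have "y \<in> W"
    using x x' assms(2) gf by (auto simp: W_def t_def homeomorphism_def)
  moreover have "smooth_on W (\<lambda>y. f' (g y + t))"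
  proof (rule smooth_on_compose[OF \<open>open W\<close> assms(5) _ _ assms(6), of "\<lambda>y. g y + t"])
    show "smooth_on W (\<lambda>y. g y + t)"
      using \<open>open W\<close> smooth_on_subset[OF assms(3), of W]
      by (intro smooth_on_add smooth_on_const) (auto simp: W_def)
  qed (auto simp: W_def)
  moreover have "f' (g y' + t) = (snd ?d \<circ> inv_into (fst ?c) (snd ?c)) y'"
    if y': "y' \<in> snd ?c ` (fst ?c \<inter> fst ?d) \<inter> W" for y'
  proof -
    obtain z where z: "z \<in> U" "z \<in> S" "y' = f (inv_into U \<pi> (\<pi> z))"
      using y' by (auto simp: lifted_chart_def)
    then have z: "z \<in> U" "z \<in> S" "y' = f z"
      using assms(4) by (simp_all add: inv_into_f_f)
    have "inj_on (f \<circ> inv_into U \<pi>) (\<pi> ` (U \<inter> S))"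
      using gf assms(4) by (intro inj_on_inverseI[of _ "\<pi> \<circ> g"]) (auto simp: inv_into_f_f)
    moreover have "(f \<circ> inv_into U \<pi>) (\<pi> z) = y'"
      using z assms(4) by (simp add: inv_into_f_f)
    ultimately have "inv_into (fst ?c) (snd ?c) y' = \<pi> z"
      using z by (intro inv_into_f_eq) (auto simp: lifted_chart_def)
    moreover have "\<pi> (z + t) = \<pi> z"
      using translation[of x x' z] x'(2) by (simp add: t_def)
    moreover have "z + t \<in> U'"
      using y' z gf by (auto simp: W_def)
    ultimately show ?thesis
      using inv_into_f_f[OF assms(7), of "z + t"] z gf by (simp add: lifted_chart_def)
  qed
  ultimately show "\<exists>W h. open W \<and> y \<in> W \<and> smooth_on W h \<and>
      (\<forall>y'\<in>snd ?c ` (fst ?c \<inter> fst ?d) \<inter> W. h y' = (snd ?d \<circ> inv_into (fst ?c) (snd ?c)) y')"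
    by blast
qed

lemma homeomorphic_maps_local_section:
  assumes "open U" "inj_on \<pi> U"
  shows "homeomorphic_maps (top_of_set U) (subtopology Q (\<pi> ` U)) \<pi> (inv_into U \<pi>)"
proof -
  have range: "\<pi> ` U \<subseteq> topspace Q" using onto by blast
  have "homeomorphic_map (top_of_set U) (subtopology Q (\<pi> ` U)) \<pi>"
  proof (rule bijective_open_imp_homeomorphic_map)
    show "continuous_map (top_of_set U) (subtopology Q (\<pi> ` U)) \<pi>"
      using cont by (auto simp: continuous_map_in_subtopology continuous_map_from_subtopology)
    show "open_map (top_of_set U) (subtopology Q (\<pi> ` U)) \<pi>"
      unfolding open_map_def
    proof (intro allI impI)
      fix W assume "openin (top_of_set U) W"
      then have "open W" "W \<subseteq> U"
        using assms(1) by (auto simp: openin_open_eq)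
      then have "openin Q (\<pi> ` W)"
        using open_map by (simp add: open_map_def)
      then show "openin (subtopology Q (\<pi> ` U)) (\<pi> ` W)"
        unfolding openin_subtopology using \<open>W \<subseteq> U\<close> by blast
    qed
  qed (use assms range in auto)
  then obtain h where h: "homeomorphic_maps (top_of_set U) (subtopology Q (\<pi> ` U)) \<pi> h"
    using homeomorphic_map_maps by blast
  show ?thesis
  proof (rule homeomorphic_maps_eq[OF h])
    fix q assume "q \<in> topspace (subtopology Q (\<pi> ` U))"
    then show "h q = inv_into U \<pi> q"
      using h assms(2) by (auto simp: homeomorphic_maps_def inv_into_f_f)
  qed auto
qed

lemma corner_chart_lifted_chart:
  assumes "X \<subseteq> topspace Q" "open U" "open V" "homeomorphism U V f g" "inj_on \<pi> U"
    and "(\<pi> -` X) \<inter> U = {y \<in> U. f y \<in> sector I}"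
  shows "corner_chart (subtopology Q X) (lifted_chart U (\<pi> -` X) f)"
proof -
  let ?dom = "\<pi> ` (U \<inter> \<pi> -` X)" and ?chart = "f \<circ> inv_into U \<pi>"
  have fU: "f ` U = V" using assms(4) by (simp add: homeomorphism_def)
  have dom: "?dom = \<pi> ` U \<inter> X" by auto
  have "openin Q (\<pi> ` U)"
    using open_map assms(2) by (simp add: open_map_def)
  then have opendom: "openin (subtopology Q X) ?dom"
    unfolding dom openin_subtopology by blast
  have image: "?chart ` ?dom = f ` (U \<inter> \<pi> -` X)"
    using assms(5) by (force simp: image_iff inv_into_f_f)
  also have "\<dots> = V \<inter> sector I"
    using assms(6) fU by blast
  finally have image': "?chart ` ?dom = V \<inter> sector I" .
  then have openimg: "openin (top_of_set (sector I)) (?chart ` ?dom)"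
    using assms(3) by (auto simp: openin_open)
  have "homeomorphic_maps (top_of_set U) (top_of_set V) f g"
    using assms(4) by (auto simp: homeomorphic_maps_def homeomorphism_def continuous_map_in_subtopology)
  then have "homeomorphic_maps (subtopology Q (\<pi> ` U)) (top_of_set V) ?chart (\<pi> \<circ> g)"
    using homeomorphic_maps_local_section[OF assms(2,5)]
    by (meson homeomorphic_maps_compose homeomorphic_maps_sym)
  then have "homeomorphic_maps (subtopology (subtopology Q (\<pi> ` U)) ?dom)
     (subtopology (top_of_set V) (?chart ` ?dom)) ?chart (\<pi> \<circ> g)"
  proof (rule homeomorphic_maps_subtopologies)
    have "topspace (subtopology Q (\<pi> ` U)) \<inter> ?dom = ?dom"
      using assms(1) by auto
    then show "?chart ` (topspace (subtopology Q (\<pi> ` U)) \<inter> ?dom) = topspace (top_of_set V) \<inter> ?chart ` ?dom"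
      using image' by auto
  qed
  moreover have "subtopology (subtopology Q (\<pi> ` U)) ?dom = subtopology (subtopology Q X) ?dom"
    unfolding subtopology_subtopology by (rule arg_cong[where f = "subtopology Q"]) auto
  moreover have "subtopology (top_of_set V) (?chart ` ?dom) = top_of_set (?chart ` ?dom)"
    using image' by (simp add: subtopology_subtopology Int_absorb1)
  ultimately have "homeomorphic_map (subtopology (subtopology Q X) ?dom) (top_of_set (?chart ` ?dom)) ?chart"
    using homeomorphic_map_maps by metis
  then show ?thesis
    using opendom openimg by (auto simp: corner_chart_def lifted_chart_def)
qed

text \<open>An open surjection maps a countable base of \<open>\<real>\<^sup>n\<close> to a countable base of the quotient.\<close>

lemma second_countable_subtopology:
  "\<exists>B. countable B \<and> (\<forall>V\<in>B. openin (subtopology Q X) V) \<and>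
     (\<forall>U x. openin (subtopology Q X) U \<and> x \<in> U \<longrightarrow> (\<exists>V\<in>B. x \<in> V \<and> V \<subseteq> U))"
proof -
  obtain \<B> :: "(real ^ 'n) set set" where \<B>: "countable \<B>" "topological_basis \<B>"
    using ex_countable_basis by blast
  let ?B = "(\<lambda>W. \<pi> ` W \<inter> X) ` \<B>"
  have "openin (subtopology Q X) (\<pi> ` W \<inter> X)" if "W \<in> \<B>" for W
    using open_map topological_basis_open[OF \<B>(2) that]
    by (auto simp: open_map_def openin_subtopology)
  moreover have "\<exists>V\<in>?B. q \<in> V \<and> V \<subseteq> U" if "openin (subtopology Q X) U" "q \<in> U" for U q
  proof -
    note qU = that(2)
    obtain T where T: "openin Q T" "U = T \<inter> X"
      using \<open>openin (subtopology Q X) U\<close> by (auto simp: openin_subtopology)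
    then have "q \<in> range \<pi>"
      using qU onto openin_subset[OF T(1)] by auto
    then obtain x where x: "\<pi> x = q" by blast
    have "open (\<pi> -` T)"
      using openin_continuous_map_preimage[OF cont T(1)] by (simp add: vimage_def)
    moreover have "x \<in> \<pi> -` T" using x T qU by simp
    ultimately obtain W where "W \<in> \<B>" "x \<in> W" "W \<subseteq> \<pi> -` T"
      by (rule topological_basisE[OF \<B>(2)])
    then show ?thesis
      using x T(2) qU by (intro bexI[of _ "\<pi> ` W \<inter> X"]) auto
  qed
  ultimately show ?thesis
    using \<B>(1) by (intro exI[of _ ?B]) auto
qed

theorem is_manifold_with_corners_in_quotient:
  assumes "X \<subseteq> topspace Q"
    and "\<And>q. q \<in> X \<Longrightarrow> \<exists>x. \<pi> x = q \<and> corner_point (\<pi> -` X) x"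
  shows "is_manifold_with_corners_in Q {(\<pi> ` V, inv_into V \<pi>) | V. open V \<and> inj_on \<pi> V} X"
proof -
  define A where "A = {lifted_chart U (\<pi> -` X) f | U V f g I. open U \<and> open V \<and> homeomorphism U V f g \<and>
     smooth_on U f \<and> smooth_on V g \<and> inj_on \<pi> U \<and> (\<pi> -` X) \<inter> U = {y \<in> U. f y \<in> sector I}}"
  have cover: "(\<Union>c\<in>A. fst c) = topspace (subtopology Q X)"
  proof
    show "(\<Union>c\<in>A. fst c) \<subseteq> topspace (subtopology Q X)"
      using assms(1) by (auto simp: A_def lifted_chart_def)
    show "topspace (subtopology Q X) \<subseteq> (\<Union>c\<in>A. fst c)"
    proof
      fix q assume "q \<in> topspace (subtopology Q X)"
      then have q: "q \<in> X" by simp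
      then obtain x where x: "\<pi> x = q" "corner_point (\<pi> -` X) x"
        using assms(2) by blast
      obtain W where W: "open W" "x \<in> W" "inj_on \<pi> W"
        using locally_inj by blast
      obtain U V I and f g :: "real ^ 'n \<Rightarrow> real ^ 'n" where *: "open U" "x \<in> U" "U \<subseteq> W" "open V" "homeomorphism U V f g"
          "smooth_on U f" "smooth_on V g" "(\<pi> -` X) \<inter> U = {y \<in> U. f y \<in> sector I}"
        by (rule corner_point_diffeomorphism[OF x(2) W(1,2)])
      then have "lifted_chart U (\<pi> -` X) f \<in> A"
        using W(3) inj_on_subset unfolding A_def by blast
      moreover have "q \<in> fst (lifted_chart U (\<pi> -` X) f)"
        using x q *(2) by (auto simp: lifted_chart_def)
      ultimately show "q \<in> (\<Union>c\<in>A. fst c)" by blast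
    qed
  qed
  have transition: "smooth_transition c (lifted_chart U' S' f')" "smooth_transition (lifted_chart U' S' f') c"
    if c: "c \<in> A" and "open U'" "open V'" "homeomorphism U' V' f' g'" "smooth_on U' f'" "smooth_on V' g'" "inj_on \<pi> U'"
    for c U' V' S' f' g'
  proof -
    obtain U V and f g :: "real ^ 'n \<Rightarrow> real ^ 'n" where "c = lifted_chart U (\<pi> -` X) f" "open U" "open V" "homeomorphism U V f g"
        "smooth_on U f" "smooth_on V g" "inj_on \<pi> U"
      using c unfolding A_def by blast
    then show "smooth_transition c (lifted_chart U' S' f')" "smooth_transition (lifted_chart U' S' f') c"
      using that smooth_transition_lifted_chart[of V U f g U' f'] smooth_transition_lifted_chart[of V' U' f' g' U f]
      by simp_all
  qed
  have "compatible c d" if "c \<in> A" and d: "d \<in> A" for c d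
  proof -
    obtain U V and f g :: "real ^ 'n \<Rightarrow> real ^ 'n" where "d = lifted_chart U (\<pi> -` X) f" "open U" "open V" "homeomorphism U V f g"
        "smooth_on U f" "smooth_on V g" "inj_on \<pi> U"
      using d unfolding A_def by blast
    then show ?thesis
      using transition[OF that(1)] by (simp add: compatible_def)
  qed
  moreover have "corner_chart (subtopology Q X) c" if "c \<in> A" for c
    using that corner_chart_lifted_chart[OF assms(1)] unfolding A_def by blast
  moreover have "compatible c (\<pi> ` V, inv_into V \<pi>)" if "c \<in> A" "open V" "inj_on \<pi> V" for c V
  proof -
    have "(\<pi> ` V, inv_into V \<pi>) = lifted_chart V UNIV (\<lambda>x. x)"
      by (auto simp: lifted_chart_def)
    moreover have "homeomorphism V V (\<lambda>x. x) (\<lambda>x. x)" "smooth_on V (\<lambda>x. x)"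
      using that(2) by (auto simp: homeomorphism_def smooth_on_id)
    ultimately show ?thesis
      using transition[OF that(1,2,2) _ _ _ that(3)] by (simp add: compatible_def)
  qed
  ultimately show ?thesis
    using cover Hausdorff second_countable_subtopology
    unfolding is_manifold_with_corners_in_def manifold_with_corners_def
    by (intro exI[of _ A]) (auto simp: Hausdorff_space_subtopology)
qed

end

section \<open>Stability of transverse systems of inequalities\<close>

definition grad :: "(real ^ 'n \<Rightarrow> real) \<Rightarrow> real ^ 'n \<Rightarrow> real ^ 'n" where
  "grad f x = (\<chi> j. frechet_derivative f (at x) (axis j 1))"

lemma grad_eqI:
  assumes "(f has_derivative (\<lambda>v. g \<bullet> v)) (at x)"
  shows "grad f x = g"
proof -
  have "frechet_derivative f (at x) = (\<lambda>v. g \<bullet> v)"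
    using frechet_derivative_at[OF assms] by simp
  then show ?thesis
    by (simp add: grad_def vec_eq_iff inner_axis)
qed

lemma has_derivative_grad:
  fixes f :: "real ^ 'n \<Rightarrow> real"
  assumes "smooth_on S f" "x \<in> S"
  shows "(f has_derivative (\<lambda>v. grad f x \<bullet> v)) (at x)"
proof -
  note deriv = smooth_on_has_derivative[OF assms]
  have lin: "linear (frechet_derivative f (at x))"
    using deriv has_derivative_linear by blast
  have "frechet_derivative f (at x) v = grad f x \<bullet> v" for v
  proof -
    have "frechet_derivative f (at x) v = frechet_derivative f (at x) (\<Sum>j\<in>UNIV. v $ j *\<^sub>R axis j 1)"
      by (simp add: basis_expansion scalar_mult_eq_scaleR[symmetric])
    also have "\<dots> = grad f x \<bullet> v"
      by (simp add: linear_sum[OF lin] linear_scale[OF lin] grad_def inner_vec_def mult.commute)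
    finally show ?thesis .
  qed
  then have "frechet_derivative f (at x) = (\<lambda>v. grad f x \<bullet> v)" by blast
  then show ?thesis using deriv by simp
qed

lemma smooth_on_grad: "smooth_on S f \<Longrightarrow> smooth_on S (\<lambda>x. grad f x $ j)"
  unfolding grad_def by (simp add: smooth_on_frechet_derivative)

lemma grad_add_mult:
  assumes "smooth_on UNIV f" "smooth_on UNIV g"
  shows "grad (\<lambda>x. f x + c * g x) x = grad f x + c *\<^sub>R grad g x"
proof (rule grad_eqI)
  show "((\<lambda>x. f x + c * g x) has_derivative (\<bullet>) (grad f x + c *\<^sub>R grad g x)) (at x)"
    by (rule derivative_eq_intros has_derivative_grad[OF assms(1)] has_derivative_grad[OF assms(2)] UNIV_I refl)+
       (simp add: inner_add_left fun_eq_iff)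
qed

lemma grad_uminus:
  assumes "smooth_on UNIV f"
  shows "grad (\<lambda>x. - f x) x = - grad f x"
  by (rule grad_eqI) (use has_derivative_minus[OF has_derivative_grad[OF assms UNIV_I]] in simp)

lemma grad_inner: "grad (\<lambda>x. w \<bullet> x) x = w"
  by (rule grad_eqI) (auto intro!: derivative_eq_intros)

lemma grad_nth_eqI:
  fixes f :: "real ^ 'n \<Rightarrow> real"
  assumes "smooth_on UNIV f" "((\<lambda>t. f (x + (t - x $ j) *\<^sub>R axis j 1)) has_real_derivative d) (at (x $ j))"
  shows "grad f x $ j = d"
proof -
  have "((\<lambda>t. x + (t - x $ j) *\<^sub>R axis j (1::real)) has_derivative (\<lambda>t. t *\<^sub>R axis j 1)) (at (x $ j))"
    by (auto intro!: derivative_eq_intros)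
  moreover have "(f has_derivative (\<lambda>v. grad f x \<bullet> v)) (at (x + (x $ j - x $ j) *\<^sub>R axis j 1))"
    using has_derivative_grad[OF assms(1) UNIV_I, of x] by simp
  ultimately have "((\<lambda>t. f (x + (t - x $ j) *\<^sub>R axis j 1)) has_derivative (\<lambda>t. grad f x \<bullet> (t *\<^sub>R axis j 1))) (at (x $ j))"
    by (rule has_derivative_compose)
  moreover have "(\<lambda>t. grad f x \<bullet> (t *\<^sub>R axis j 1)) = (*) (grad f x $ j)"
    by (simp add: inner_axis fun_eq_iff)
  ultimately have "((\<lambda>t. f (x + (t - x $ j) *\<^sub>R axis j 1)) has_real_derivative (grad f x $ j)) (at (x $ j))"
    by (simp add: has_field_derivative_def)
  then show ?thesis using DERIV_unique assms(2) by blast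
qed

lemma jac_nth:
  assumes "smooth_on S f" "x \<in> S"
  shows "jac f x $ k = grad (\<lambda>x. f x $ k) x"
proof -
  have "((\<lambda>x. f x $ k) has_derivative (\<lambda>v. frechet_derivative f (at x) v $ k)) (at x)"
    by (rule bounded_linear.has_derivative[OF bounded_linear_vec_nth smooth_on_has_derivative[OF assms]])
  then have "frechet_derivative (\<lambda>x. f x $ k) (at x) = (\<lambda>v. frechet_derivative f (at x) v $ k)"
    using frechet_derivative_at by metis
  then show ?thesis
    by (simp add: jac_def matrix_def grad_def)
qed

text \<open>The vectors are completed to a basis; a vector that the resulting matrix annihilates is
  orthogonal to this basis. The injection \<open>r\<close> assigns a row to each of the given vectors.\<close>

lemma extend_rows_to_nonsingular:
  fixes g :: "'i \<Rightarrow> real ^ 'n"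
  assumes "finite J"
    and indep: "\<And>c. (\<Sum>i\<in>J. c i *\<^sub>R g i) = 0 \<Longrightarrow> \<forall>i\<in>J. c i = 0"
  obtains r and A :: "real ^ 'n ^ 'n" where "inj_on r J" "\<And>i. i \<in> J \<Longrightarrow> A $ r i = g i" "det A \<noteq> 0"
proof -
  have inj: "inj_on g J"
  proof (rule inj_onI, rule ccontr)
    fix i j assume *: "i \<in> J" "j \<in> J" "g i = g j" "i \<noteq> j"
    let ?c = "\<lambda>k. if k = i then 1 else if k = j then - 1 else 0 :: real"
    have "(\<Sum>k\<in>J. ?c k *\<^sub>R g k) = (\<Sum>k\<in>{i, j}. ?c k *\<^sub>R g k)"
      using * assms(1) by (intro sum.mono_neutral_right) auto
    also have "\<dots> = 0" using * by simp
    finally show False using indep[of ?c] *(1) by auto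
  qed
  have "independent (g ` J)"
  proof (rule independent_if_scalars_zero)
    fix c v assume *: "(\<Sum>x\<in>g ` J. c x *\<^sub>R x) = 0" "v \<in> g ` J"
    then show "c v = 0"
      using indep[of "\<lambda>i. c (g i)"] by (auto simp: sum.reindex[OF inj])
  qed (use assms in auto)
  then obtain B where B: "g ` J \<subseteq> B" "independent B" "span B = UNIV"
    using extend_basis_superset span_extend_basis independent_extend_basis by metis
  have "finite B" using B(2) independent_imp_finite by blast
  moreover have "card B = CARD('n)"
    using B(2,3) dim_eq_card_independent[OF B(2)] dim_span[of B] by (metis dim_UNIV DIM_cart DIM_real mult.right_neutral)
  ultimately obtain h where h: "bij_betw h (UNIV :: 'n set) B"
    using finite_same_card_bij[of "UNIV :: 'n set" B] by auto
  define A where "A = (\<chi> k. h k)"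
  define r where "r = (\<lambda>i. inv_into UNIV h (g i))"
  have hr: "h (r i) = g i" if "i \<in> J" for i
    using that B(1) h by (auto simp: r_def bij_betw_def intro!: f_inv_into_f)
  have "x = 0" if "A *v x = 0" for x
  proof -
    have "h k \<bullet> x = 0" for k
      using arg_cong[OF that, of "\<lambda>v. v $ k"]
      by (simp add: A_def matrix_vector_mult_def inner_vec_def)
    then have "orthogonal x v" if "v \<in> B" for v
      using h that by (auto simp: bij_betw_def orthogonal_def inner_commute)
    then have "orthogonal x x"
      using orthogonal_to_span[of x B x] B(3) by auto
    then show ?thesis by (simp add: orthogonal_def)
  qed
  then have "det A \<noteq> 0"
    using matrix_left_invertible_ker[of A] invertible_left_inverse[of A] invertible_det_nz[of A] by blast
  moreover have "inj_on r J"
    using hr inj by (metis inj_on_def)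
  ultimately show ?thesis
    using that[of r A] hr by (simp add: A_def)
qed

text \<open>The constraints that are active at \<open>x0\<close>, perturbed and completed by linear functions, form a map
  whose Jacobian determinant is continuous in \<open>(\<epsilon>, y)\<close> and nonzero at \<open>(0, x0)\<close>, hence nonzero
  nearby. A constraint with \<open>a i x0 \<noteq> 0\<close> keeps its sign near \<open>(0, x0)\<close>: it is either satisfied
  automatically or excludes all points nearby.\<close>

theorem transverse_inequalities_stable:
  fixes a b :: "'i \<Rightarrow> real ^ 'n \<Rightarrow> real"
  assumes "finite J"
    and smooth: "\<And>i. i \<in> J \<Longrightarrow> smooth_on UNIV (a i)" "\<And>i. i \<in> J \<Longrightarrow> smooth_on UNIV (b i)"
    and indep: "\<And>c. (\<Sum>i | i \<in> J \<and> a i x0 = 0. c i *\<^sub>R grad (a i) x0) = 0 \<Longrightarrow>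
        \<forall>i\<in>J. a i x0 = 0 \<longrightarrow> c i = 0"
  shows "\<exists>\<eta>>0. \<forall>\<epsilon> x. \<bar>\<epsilon>\<bar> < \<eta> \<longrightarrow> x \<in> ball x0 \<eta> \<longrightarrow> (\<forall>i\<in>J. 0 \<le> a i x + \<epsilon> * b i x) \<longrightarrow>
      corner_point {y. \<forall>i\<in>J. 0 \<le> a i y + \<epsilon> * b i y} x"
proof -
  define J0 where "J0 = {i \<in> J. a i x0 = 0}"
  have fin: "finite J0" and sub: "J0 \<subseteq> J" using assms(1) by (auto simp: J0_def)
  have indep0: "\<forall>i\<in>J0. c i = 0" if "(\<Sum>i\<in>J0. c i *\<^sub>R grad (a i) x0) = 0" for c
    using indep[of c] that by (auto simp: J0_def)
  obtain r and A :: "real ^ 'n ^ 'n" where r: "inj_on r J0"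
      and A: "\<And>i. i \<in> J0 \<Longrightarrow> A $ r i = grad (a i) x0" "det A \<noteq> 0"
    by (rule extend_rows_to_nonsingular[OF fin, of "\<lambda>i. grad (a i) x0", OF indep0]) blast+
  let ?i = "inv_into J0 r"
  have iJ0: "?i k \<in> J" "?i k \<in> J0" if "k \<in> r ` J0" for k
    using that inv_into_into[of k r J0] sub by auto
  \<comment> \<open>Row \<open>k\<close> carries the constraint with index \<open>?i k\<close> if there is one, else a linear function.\<close>
  define f where "f = (\<lambda>\<epsilon> y. \<chi> k. if k \<in> r ` J0 then a (?i k) y + \<epsilon> * b (?i k) y else A $ k \<bullet> y)"
  define M where "M = (\<lambda>\<epsilon> y. \<chi> k j. if k \<in> r ` J0 then grad (a (?i k)) y $ j + \<epsilon> * grad (b (?i k)) y $ j else A $ k $ j)"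
  have smooth_f: "smooth_on UNIV (f \<epsilon>)" for \<epsilon>
    unfolding f_def
  proof (rule smooth_on_vec_lambda)
    fix k
    show "smooth_on UNIV (\<lambda>y. if k \<in> r ` J0 then a (?i k) y + \<epsilon> * b (?i k) y else A $ k \<bullet> y)"
      using iJ0(1)[of k] smooth by (cases "k \<in> r ` J0") (auto intro!: smooth_intros)
  qed auto
  have jac_f: "jac (f \<epsilon>) y = M \<epsilon> y" for \<epsilon> y
  proof -
    have "jac (f \<epsilon>) y $ k = M \<epsilon> y $ k" for k
    proof -
      have "jac (f \<epsilon>) y $ k = grad (\<lambda>y. f \<epsilon> y $ k) y"
        by (rule jac_nth[OF smooth_f UNIV_I])
      also have "\<dots> = M \<epsilon> y $ k"
      proof (cases "k \<in> r ` J0")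
        case True
        then have "grad (\<lambda>y. f \<epsilon> y $ k) y = grad (a (?i k)) y + \<epsilon> *\<^sub>R grad (b (?i k)) y"
          using grad_add_mult[OF smooth(1,2)[OF iJ0(1)[OF True]]] by (simp add: f_def)
        with True show ?thesis by (simp add: M_def vec_eq_iff)
      next
        case False
        then show ?thesis by (simp add: f_def M_def vec_eq_iff grad_inner)
      qed
      finally show ?thesis .
    qed
    then show ?thesis by (simp add: vec_eq_iff)
  qed
  have M0: "M 0 x0 = A"
  proof -
    have "M 0 x0 $ k = A $ k" for k
    proof (cases "k \<in> r ` J0")
      case True
      then show ?thesis
        using A(1)[OF iJ0(2)[OF True]] f_inv_into_f[OF True]
        by (simp add: M_def vec_eq_iff)
    qed (simp add: M_def vec_eq_iff)
    then show ?thesis by (simp add: vec_eq_iff)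
  qed
  have isCont: "isCont (\<lambda>p. h (snd p)) (0 :: real, x0)" if "smooth_on UNIV h" for h :: "real ^ 'n \<Rightarrow> real"
    by (rule isCont_o2[where f = snd, unfolded o_def])
       (use smooth_on_imp_continuous_on[OF that] in \<open>auto intro: continuous_intros simp: continuous_on_eq_continuous_at\<close>)
  have "isCont (\<lambda>p. det (M (fst p) (snd p))) (0, x0)"
    unfolding det_def
  proof (intro continuous_sum continuous_mult continuous_prod continuous_const)
    fix p :: "'n \<Rightarrow> 'n" and k :: 'n
    show "isCont (\<lambda>q. M (fst q) (snd q) $ k $ p k) (0, x0)"
    proof (cases "k \<in> r ` J0")
      case True
      then show ?thesis
        using iJ0(1)[OF True] smooth isCont[OF smooth_on_grad]
        by (auto simp: M_def intro!: continuous_intros)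
    qed (simp add: M_def)
  qed
  then have "((\<lambda>p. det (M (fst p) (snd p))) \<longlongrightarrow> det A) (nhds (0, x0))"
    using tendsto_at_iff_tendsto_nhds[of "\<lambda>p. det (M (fst p) (snd p))" "(0, x0)"]
    by (simp add: isCont_def M0)
  then have ev_det: "\<forall>\<^sub>F p in nhds (0, x0). det (M (fst p) (snd p)) \<noteq> 0"
    using A(2) tendsto_imp_eventually_ne by blast
  have "\<forall>\<^sub>F p in nhds (0, x0). (0 < a i x0 \<longrightarrow> 0 < a i (snd p) + fst p * b i (snd p)) \<and>
      (a i x0 < 0 \<longrightarrow> a i (snd p) + fst p * b i (snd p) < 0)" if "i \<in> J" for i
  proof -
    have "isCont (\<lambda>p. a i (snd p) + fst p * b i (snd p)) (0, x0)"
      using isCont smooth that by (intro continuous_intros) auto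
    then have lim: "((\<lambda>p. a i (snd p) + fst p * b i (snd p)) \<longlongrightarrow> a i x0) (nhds (0, x0))"
      using tendsto_at_iff_tendsto_nhds[of "\<lambda>p. a i (snd p) + fst p * b i (snd p)" "(0, x0)"]
      by (simp add: isCont_def)
    show ?thesis
      using order_tendstoD(1)[OF lim, of 0] order_tendstoD(2)[OF lim, of 0]
      by (cases "a i x0" "0 :: real" rule: linorder_cases) (auto elim: eventually_mono)
  qed
  then have ev_sign: "\<forall>\<^sub>F p in nhds (0, x0). \<forall>i\<in>J. (0 < a i x0 \<longrightarrow> 0 < a i (snd p) + fst p * b i (snd p)) \<and>
      (a i x0 < 0 \<longrightarrow> a i (snd p) + fst p * b i (snd p) < 0)"
    using assms(1) by (simp add: eventually_ball_finite)
  obtain P1 P2 where P: "eventually P1 (nhds 0)" "eventually P2 (nhds x0)"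
    and good: "\<And>\<epsilon> y. P1 \<epsilon> \<Longrightarrow> P2 y \<Longrightarrow> det (M \<epsilon> y) \<noteq> 0 \<and>
      (\<forall>i\<in>J. (0 < a i x0 \<longrightarrow> 0 < a i y + \<epsilon> * b i y) \<and> (a i x0 < 0 \<longrightarrow> a i y + \<epsilon> * b i y < 0))"
    using eventually_conj[OF ev_det ev_sign] unfolding nhds_prod eventually_prod_filter by auto
  obtain d1 d2 where d: "d1 > 0" "\<And>\<epsilon>. dist \<epsilon> 0 < d1 \<Longrightarrow> P1 \<epsilon>" "d2 > 0" "\<And>y. dist y x0 < d2 \<Longrightarrow> P2 y"
    using P unfolding eventually_nhds_metric by auto
  let ?\<eta> = "min d1 d2"
  have "corner_point {y. \<forall>i\<in>J. 0 \<le> a i y + \<epsilon> * b i y} x" (is "corner_point ?S x")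
    if "\<bar>\<epsilon>\<bar> < ?\<eta>" "x \<in> ball x0 ?\<eta>" "\<forall>i\<in>J. 0 \<le> a i x + \<epsilon> * b i x" for \<epsilon> x
  proof -
    have near: "det (M \<epsilon> y) \<noteq> 0"
        "\<forall>i\<in>J. (0 < a i x0 \<longrightarrow> 0 < a i y + \<epsilon> * b i y) \<and> (a i x0 < 0 \<longrightarrow> a i y + \<epsilon> * b i y < 0)"
      if "y \<in> ball x0 ?\<eta>" for y
      using good[OF d(2,4), of \<epsilon> y] \<open>\<bar>\<epsilon>\<bar> < ?\<eta>\<close> that by (auto simp: dist_commute)
    have inactive: "0 < a i x0" if "i \<in> J" "i \<notin> J0" for i
      using near(2)[OF \<open>x \<in> ball x0 ?\<eta>\<close>] \<open>\<forall>i\<in>J. 0 \<le> a i x + \<epsilon> * b i x\<close> that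
      by (force simp: J0_def)
    have sector: "f \<epsilon> y \<in> sector (r ` J0) \<longleftrightarrow> (\<forall>i\<in>J0. 0 \<le> a i y + \<epsilon> * b i y)" for y
      using r by (auto simp: sector_def f_def)
    have "?S \<inter> ball x0 ?\<eta> = {y \<in> ball x0 ?\<eta>. f \<epsilon> y \<in> sector (r ` J0)}"
    proof (intro set_eqI iffI)
      fix y assume "y \<in> {y \<in> ball x0 ?\<eta>. f \<epsilon> y \<in> sector (r ` J0)}"
      then have y: "y \<in> ball x0 ?\<eta>" "\<forall>i\<in>J0. 0 \<le> a i y + \<epsilon> * b i y"
        by (auto simp: sector)
      have "0 \<le> a i y + \<epsilon> * b i y" if "i \<in> J" for i
        using y near(2)[OF y(1)] inactive[OF that] that by (cases "i \<in> J0") (auto intro: less_imp_le)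
      then show "y \<in> ?S \<inter> ball x0 ?\<eta>" using y by auto
    qed (use sub sector in auto)
    then show ?thesis
      unfolding corner_point_def
      using near(1)[OF that(2)] that(2) smooth_on_subset[OF smooth_f]
      by (intro exI[of _ "ball x0 ?\<eta>"] exI[of _ "f \<epsilon>"] exI[of _ "r ` J0"]) (simp add: jac_f)
  qed
  then show ?thesis
    using d(1,3) by (intro exI[of _ ?\<eta>]) auto
qed

section \<open>The circle and the space of chords as quotients\<close>

lemma circle_class_eq_iff:
  "circle_class P s = circle_class P t \<longleftrightarrow> (\<exists>k :: int. t = s + of_int k * P)"
proof
  assume "circle_class P s = circle_class P t"
  moreover have "t \<in> circle_class P t"
    unfolding circle_class_def by (auto intro: exI[of _ 0])
  ultimately show "\<exists>k :: int. t = s + of_int k * P"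
    by (auto simp: circle_class_def)
next
  assume "\<exists>k :: int. t = s + of_int k * P"
  then obtain k :: int where k: "t = s + of_int k * P" by blast
  have "x \<in> circle_class P s \<longleftrightarrow> x \<in> circle_class P t" for x
  proof
    assume "x \<in> circle_class P s"
    then obtain l :: int where "x = s + of_int l * P" by (auto simp: circle_class_def)
    then have "x = t + of_int (l - k) * P" by (simp add: k algebra_simps)
    then show "x \<in> circle_class P t" unfolding circle_class_def by blast
  next
    assume "x \<in> circle_class P t"
    then obtain l :: int where "x = t + of_int l * P" by (auto simp: circle_class_def)
    then have "x = s + of_int (l + k) * P" by (simp add: k algebra_simps)
    then show "x \<in> circle_class P s" unfolding circle_class_def by blast
  qed
  then show "circle_class P s = circle_class P t" by blast
qed

lemma circle_class_translation:
  assumes "circle_class P s = circle_class P t"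
  shows "circle_class P (r + (t - s)) = circle_class P r"
proof -
  obtain k :: int where "t = s + of_int k * P"
    using assms circle_class_eq_iff by blast
  then have "r = (r + (t - s)) + of_int (- k) * P" by simp
  then show ?thesis unfolding circle_class_eq_iff by blast
qed

lemma circle_class_inj_near:
  assumes "circle_class P s = circle_class P t" "\<bar>s - t\<bar> < P"
  shows "s = t"
proof -
  obtain k :: int where k: "t = s + of_int k * P"
    using assms(1) circle_class_eq_iff by blast
  have "P > 0" using assms(2) by linarith
  then have "\<bar>real_of_int k\<bar> < 1"
    using assms(2) by (simp add: k abs_mult)
  then have "k = 0" by linarith
  then show ?thesis using k by simp
qed

lemma topspace_circle [simp]: "topspace (circle P) = range (circle_class P)"
proof -
  have "openin (circle P) (range (circle_class P))"
    by (simp add: openin_circle vimage_def)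
  then show ?thesis
    by (metis openin_circle openin_subset openin_topspace subset_antisym)
qed

lemma continuous_map_circle_class: "continuous_map euclidean (circle P) (circle_class P)"
  by (auto simp: continuous_map_def openin_circle vimage_def)

lemma open_map_circle_class: "open_map euclidean (circle P) (circle_class P)"
  unfolding open_map_def
proof (intro allI impI)
  fix U :: "real set" assume "openin euclidean U"
  then have "open U" by simp
  have "circle_class P -` circle_class P ` U = (\<Union>k :: int. (+) (of_int k * P) ` U)"
  proof (rule set_eqI)
    fix t
    have "t \<in> circle_class P -` circle_class P ` U \<longleftrightarrow> (\<exists>s\<in>U. circle_class P s = circle_class P t)"
      by (auto simp: image_iff)
    also have "\<dots> \<longleftrightarrow> t \<in> (\<Union>k :: int. (+) (of_int k * P) ` U)"
      by (auto simp: circle_class_eq_iff add.commute)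
    finally show "t \<in> circle_class P -` circle_class P ` U \<longleftrightarrow> t \<in> (\<Union>k :: int. (+) (of_int k * P) ` U)" .
  qed
  then show "openin (circle P) (circle_class P ` U)"
    using open_translation[OF \<open>open U\<close>] by (auto simp: openin_circle)
qed

text \<open>The exponential map embeds the circle into the complex plane.\<close>

lemma Hausdorff_circle:
  assumes "P \<noteq> 0"
  shows "Hausdorff_space (circle P)"
proof -
  define f where "f = (\<lambda>a. cis (2 * pi * ((SOME s. s \<in> a) / P)))"
  have f: "f (circle_class P s) = cis (2 * pi * (s / P))" for s
  proof -
    have "s \<in> circle_class P s"
      unfolding circle_class_def by (auto intro: exI[of _ 0])
    then have "(SOME t. t \<in> circle_class P s) \<in> circle_class P s" by (rule someI)
    then obtain k :: int where "(SOME t. t \<in> circle_class P s) = s + of_int k * P"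
      by (auto simp: circle_class_def)
    then have "f (circle_class P s) = cis (2 * pi * (s / P) + 2 * pi * of_int k)"
      using assms by (simp add: f_def field_simps)
    then show ?thesis by (simp flip: cis_mult)
  qed
  show ?thesis
  proof (rule Hausdorff_space_injective_preimage)
    show "continuous_map (circle P) euclidean f"
      unfolding continuous_map_def
    proof (intro conjI allI impI)
      fix U :: "complex set" assume "openin euclidean U"
      then have "open ((\<lambda>s. cis (2 * pi * (s / P))) -` U)"
        by (intro open_vimage) (auto intro!: continuous_intros simp: assms)
      moreover have "circle_class P -` {a \<in> topspace (circle P). f a \<in> U} = (\<lambda>s. cis (2 * pi * (s / P))) -` U"
        by (auto simp: f)
      ultimately show "openin (circle P) {a \<in> topspace (circle P). f a \<in> U}"
        by (auto simp: openin_circle)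
    qed auto
    show "inj_on f (topspace (circle P))"
    proof (rule inj_onI)
      fix a b assume "a \<in> topspace (circle P)" "b \<in> topspace (circle P)" "f a = f b"
      then obtain s t where st: "a = circle_class P s" "b = circle_class P t" "cis (2 * pi * (s / P)) = cis (2 * pi * (t / P))"
        by (auto simp: f)
      then have "sin (2 * pi * (t / P)) = sin (2 * pi * (s / P)) \<and> cos (2 * pi * (t / P)) = cos (2 * pi * (s / P))"
        by (simp add: complex_eq_iff)
      then obtain n :: int where "2 * pi * (t / P) = 2 * pi * (s / P) + 2 * pi * n"
        unfolding sin_cos_eq_iff by blast
      then have "2 * pi * (t / P) = 2 * pi * (s / P + n)"
        by (simp add: distrib_left)
      then have "t / P = s / P + n"
        by (subst (asm) mult_left_cancel) simp_all
      then have "t = s + n * P" using assms by (simp add: field_simps)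
      then show "a = b" using st circle_class_eq_iff by blast
    qed
  qed auto
qed

lemma ex_vec4: "\<exists>x :: real ^ 4. x $ 1 = a \<and> x $ 2 = b \<and> x $ 3 = c \<and> x $ 4 = d"
  by (rule exI[of _ "\<chi> i. if i = 1 then a else if i = 2 then b else if i = 3 then c else d"]) simp

lemma topspace_chord_space:
  "topspace (chord_space T) = (range (circle_class T) \<times> range (circle_class (2 * pi))) \<times>
     (range (circle_class T) \<times> range (circle_class (2 * pi)))"
  by (simp add: chord_space_def)

lemma chord_class_image_box:
  "chord_class T ` {x. \<forall>i. x $ i \<in> A i} =
     (circle_class T ` A 1 \<times> circle_class (2 * pi) ` A 2) \<times> (circle_class T ` A 3 \<times> circle_class (2 * pi) ` A 4)"
proof
  show "chord_class T ` {x. \<forall>i. x $ i \<in> A i} \<subseteq>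
     (circle_class T ` A 1 \<times> circle_class (2 * pi) ` A 2) \<times> (circle_class T ` A 3 \<times> circle_class (2 * pi) ` A 4)"
    by (auto simp: chord_class_def)
  show "(circle_class T ` A 1 \<times> circle_class (2 * pi) ` A 2) \<times> (circle_class T ` A 3 \<times> circle_class (2 * pi) ` A 4)
     \<subseteq> chord_class T ` {x. \<forall>i. x $ i \<in> A i}"
  proof
    fix q assume "q \<in> (circle_class T ` A 1 \<times> circle_class (2 * pi) ` A 2) \<times> (circle_class T ` A 3 \<times> circle_class (2 * pi) ` A 4)"
    then obtain a b c d where *: "a \<in> A 1" "b \<in> A 2" "c \<in> A 3" "d \<in> A 4"
        "q = ((circle_class T a, circle_class (2 * pi) b), (circle_class T c, circle_class (2 * pi) d))"
      by auto
    obtain x :: "real ^ 4" where "x $ 1 = a" "x $ 2 = b" "x $ 3 = c" "x $ 4 = d"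
      using ex_vec4 by blast
    then show "q \<in> chord_class T ` {x. \<forall>i. x $ i \<in> A i}"
      using * by (intro image_eqI[of _ _ x]) (auto simp: chord_class_def forall_4)
  qed
qed

lemma range_chord_class: "range (chord_class T) = topspace (chord_space T)"
  using chord_class_image_box[of T "\<lambda>_. UNIV"] by (simp add: topspace_chord_space)

lemma continuous_map_chord_class: "continuous_map euclidean (chord_space T) (chord_class T)"
proof -
  have nth: "continuous_map euclidean (circle P) (\<lambda>x :: real ^ 4. circle_class P (x $ i))" for P i
    using continuous_map_compose[OF _ continuous_map_circle_class, of euclidean "\<lambda>x :: real ^ 4. x $ i" P]
    by (simp add: o_def continuous_intros)
  show ?thesis
    unfolding chord_space_def chord_class_def
    by (intro continuous_map_pairedI nth)
qed

lemma open_map_chord_class: "open_map euclidean (chord_space T) (chord_class T)"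
  unfolding open_map_def
proof (intro allI impI)
  fix V :: "(real ^ 4) set" assume "openin euclidean V"
  then have "open V" by simp
  show "openin (chord_space T) (chord_class T ` V)"
  proof (subst openin_subopen, intro ballI)
    fix q assume "q \<in> chord_class T ` V"
    then obtain x where x: "x \<in> V" "q = chord_class T x" by blast
    obtain A where A: "\<And>i. open (A i) \<and> x $ i \<in> A i" "\<And>y. \<forall>i. y $ i \<in> A i \<Longrightarrow> y \<in> V"
      using \<open>open V\<close> x(1) unfolding open_vec_def by blast
    have "openin (circle P) (circle_class P ` A i)" for P i
      using open_map_circle_class[of P] A(1) by (simp add: open_map_def)
    then have "openin (chord_space T) (chord_class T ` {y. \<forall>i. y $ i \<in> A i})"
      unfolding chord_class_image_box chord_space_def by (simp add: openin_prod_Times_iff)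
    moreover have "q \<in> chord_class T ` {y. \<forall>i. y $ i \<in> A i}" using x A(1) by blast
    moreover have "chord_class T ` {y. \<forall>i. y $ i \<in> A i} \<subseteq> chord_class T ` V" using A(2) by blast
    ultimately show "\<exists>W. openin (chord_space T) W \<and> q \<in> W \<and> W \<subseteq> chord_class T ` V" by blast
  qed
qed

lemma translation_quotient_chord_class:
  assumes "T > 0"
  shows "translation_quotient (chord_class T) (chord_space T)"
proof
  show "\<exists>U. open U \<and> x \<in> U \<and> inj_on (chord_class T) U" for x
  proof (intro exI conjI)
    let ?U = "ball x (min T (2 * pi) / 2)"
    show "inj_on (chord_class T) ?U"
    proof (rule inj_onI)
      fix y z assume *: "y \<in> ?U" "z \<in> ?U" "chord_class T y = chord_class T z"
      then have "dist y z < min T (2 * pi)"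
        using dist_triangle3[of y z x] by auto
      then have "\<bar>y $ i - z $ i\<bar> < T" "\<bar>y $ i - z $ i\<bar> < 2 * pi" for i
        using component_le_norm_cart[of "y - z" i] by (simp_all add: dist_norm)
      then show "y = z"
        using *(3) circle_class_inj_near by (auto simp: vec_eq_iff forall_4 chord_class_def)
    qed
  qed (use assms in auto)
  show "chord_class T (z + (y - x)) = chord_class T z" if "chord_class T x = chord_class T y" for x y z
    using that circle_class_translation by (simp add: chord_class_def)
  show "Hausdorff_space (chord_space T)"
    using Hausdorff_circle assms by (simp add: chord_space_def Hausdorff_space_prod_topology)
qed (use continuous_map_chord_class open_map_chord_class range_chord_class in auto)

lemma chord_space_manifold_with_cornersI:
  assumes "T > 0" "X \<subseteq> topspace (chord_space T)"
    and "\<And>q. q \<in> X \<Longrightarrow> \<exists>x. chord_class T x = q \<and> corner_point (chord_class T -` X) x"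
  shows "is_manifold_with_corners_in (chord_space T) (chord_space_atlas T) X"
  unfolding chord_space_atlas_def
  by (rule translation_quotient.is_manifold_with_corners_in_quotient[OF translation_quotient_chord_class[OF assms(1)] assms(2,3)])

lemma le_circle_dist_iff:
  "\<delta> \<le> circle_dist (circle_class T s) (circle_class T t) \<longleftrightarrow> (\<forall>k :: int. \<delta> \<le> \<bar>t - s + of_int k * T\<bar>)"
proof
  assume L: "\<delta> \<le> circle_dist (circle_class T s) (circle_class T t)"
  show "\<forall>k :: int. \<delta> \<le> \<bar>t - s + of_int k * T\<bar>"
  proof
    fix k :: int
    have "s \<in> circle_class T s" "t + of_int k * T \<in> circle_class T t"
      by (auto simp: circle_class_def intro: exI[of _ 0])
    then have "\<delta> \<le> dist s (t + of_int k * T)"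
      using L setdist_le_dist unfolding circle_dist_def by (meson order_trans)
    then show "\<delta> \<le> \<bar>t - s + of_int k * T\<bar>" by (simp add: dist_real_def)
  qed
next
  assume R: "\<forall>k :: int. \<delta> \<le> \<bar>t - s + of_int k * T\<bar>"
  show "\<delta> \<le> circle_dist (circle_class T s) (circle_class T t)"
    unfolding circle_dist_def
  proof (rule le_setdistI)
    fix x y assume "x \<in> circle_class T s" "y \<in> circle_class T t"
    then obtain k l :: int where "x = s + of_int k * T" "y = t + of_int l * T"
      by (auto simp: circle_class_def)
    then show "\<delta> \<le> dist x y"
      using R[rule_format, of "l - k"] by (simp add: dist_real_def algebra_simps abs_minus_commute)
  qed (auto simp: circle_class_def)
qed

section \<open>The Frenet frame\<close>

lemma has_vector_derivative_smooth:
  assumes "smooth_on UNIV f"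
  shows "(f has_vector_derivative vector_derivative f (at s)) (at (s :: real))"
proof -
  have "f differentiable (at s)"
    using smooth_on_has_derivative[OF assms UNIV_I] differentiableI by blast
  then show ?thesis by (simp add: vector_derivative_works)
qed

lemma has_real_derivative_inner:
  fixes f g :: "real \<Rightarrow> 'a::real_inner"
  assumes "(f has_vector_derivative f') (at s)" "(g has_vector_derivative g') (at s)"
  shows "((\<lambda>t. f t \<bullet> g t) has_real_derivative (f s \<bullet> g' + f' \<bullet> g s)) (at s)"
  using bounded_bilinear.has_vector_derivative[OF bounded_bilinear_inner assms]
  by (simp add: has_real_derivative_iff_has_vector_derivative)

lemma inner_derivative_eq_0:
  fixes f g :: "real \<Rightarrow> 'a::real_inner"
  assumes "(f has_vector_derivative f') (at s)" "(g has_vector_derivative g') (at s)" "\<And>t. f t \<bullet> g t = c"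
  shows "f s \<bullet> g' + f' \<bullet> g s = 0"
  using has_real_derivative_inner[OF assms(1,2)] DERIV_unique[OF _ DERIV_const[of c "at s"]]
  by (simp add: assms(3))

lemma vector_derivative_periodic:
  fixes f :: "real \<Rightarrow> 'a::real_normed_vector"
  assumes "smooth_on UNIV f" "\<And>r. f (r + c) = f r"
  shows "vector_derivative f (at (s + c)) = vector_derivative f (at s)"
proof -
  have "((\<lambda>r. r + c) has_vector_derivative 1) (at s)"
    by (auto intro!: derivative_eq_intros)
  then have "(f \<circ> (\<lambda>r. r + c) has_vector_derivative 1 *\<^sub>R vector_derivative f (at (s + c))) (at s)"
    by (rule vector_diff_chain_at) (rule has_vector_derivative_smooth[OF assms(1)])
  moreover have "f \<circ> (\<lambda>r. r + c) = f" using assms(2) by auto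
  ultimately have "(f has_vector_derivative vector_derivative f (at (s + c))) (at s)" by simp
  then show ?thesis by (rule vector_derivative_at[symmetric])
qed

text \<open>The properties of a generic knot that make its Frenet frame exist and depend smoothly on the point.\<close>

locale frenet_curve =
  fixes \<gamma> :: "real \<Rightarrow> real ^ 3"
  assumes smooth: "smooth_on UNIV \<gamma>"
    and unit_speed: "\<And>s. norm (velocity \<gamma> s) = 1"
    and curved: "\<And>s. acceleration \<gamma> s \<noteq> 0"
begin

lemma smooth_velocity: "smooth_on UNIV (velocity \<gamma>)"
  using smooth_on_vector_derivative[OF open_UNIV smooth] by (simp add: velocity_def[abs_def])

lemma smooth_acceleration: "smooth_on UNIV (acceleration \<gamma>)"
  using smooth_on_vector_derivative[OF open_UNIV smooth_velocity] by (simp add: acceleration_def[abs_def])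

lemma smooth_normal: "smooth_on UNIV (normal \<gamma>)"
  unfolding normal_def[abs_def]
  by (intro smooth_on_scaleR smooth_on_inverse smooth_on_norm smooth_acceleration open_UNIV) (simp_all add: curved)

lemma smooth_binormal: "smooth_on UNIV (binormal \<gamma>)"
  unfolding binormal_def[abs_def]
  by (intro smooth_on_cross3 smooth_velocity smooth_normal open_UNIV)

lemma smooth_tube_normal:
  assumes "open S" "smooth_on S f" "smooth_on S g"
  shows "smooth_on S (\<lambda>x. tube_normal \<gamma> (f x) (g x))"
  unfolding tube_normal_def
  by (intro smooth_intros assms smooth_on_compose_UNIV[of S "normal \<gamma>"] smooth_normal
      smooth_on_compose_UNIV[of S "binormal \<gamma>"] smooth_binormal)

lemma has_vector_derivative_curve: "(\<gamma> has_vector_derivative velocity \<gamma> s) (at s)"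
  unfolding velocity_def by (rule has_vector_derivative_smooth[OF smooth])

lemma has_vector_derivative_velocity: "(velocity \<gamma> has_vector_derivative acceleration \<gamma> s) (at s)"
  unfolding acceleration_def by (rule has_vector_derivative_smooth[OF smooth_velocity])

lemma velocity_inner_self: "velocity \<gamma> s \<bullet> velocity \<gamma> s = 1"
  using unit_speed[of s] by (simp add: norm_eq_1)

lemma velocity_acceleration: "velocity \<gamma> s \<bullet> acceleration \<gamma> s = 0"
  using inner_derivative_eq_0[OF has_vector_derivative_velocity has_vector_derivative_velocity velocity_inner_self]
  by (simp add: inner_commute)

lemma velocity_normal: "velocity \<gamma> s \<bullet> normal \<gamma> s = 0"
  by (simp add: normal_def velocity_acceleration)

lemma normal_inner_self: "normal \<gamma> s \<bullet> normal \<gamma> s = 1"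
  using curved[of s] by (simp add: normal_def dot_square_norm power2_eq_square)

lemma velocity_binormal: "velocity \<gamma> s \<bullet> binormal \<gamma> s = 0"
  and normal_binormal: "normal \<gamma> s \<bullet> binormal \<gamma> s = 0"
  by (simp_all add: binormal_def dot_cross_self)

lemma binormal_inner_self: "binormal \<gamma> s \<bullet> binormal \<gamma> s = 1"
  unfolding binormal_def dot_cross
  by (simp add: velocity_inner_self normal_inner_self velocity_normal inner_commute[of "normal \<gamma> s" "velocity \<gamma> s"])

lemma tube_normal_inner_self: "tube_normal \<gamma> s \<theta> \<bullet> tube_normal \<gamma> s \<theta> = 1"
  unfolding tube_normal_def
  by (simp add: inner_add_left inner_add_right normal_inner_self binormal_inner_self normal_binormal
      inner_commute[of "binormal \<gamma> s" "normal \<gamma> s"] flip: power2_eq_square)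

lemma velocity_tube_normal: "velocity \<gamma> s \<bullet> tube_normal \<gamma> s \<theta> = 0"
  by (simp add: tube_normal_def inner_add_right velocity_normal velocity_binormal)

lemma acceleration_tube_normal: "acceleration \<gamma> s \<bullet> tube_normal \<gamma> s \<theta> = cos \<theta> * norm (acceleration \<gamma> s)"
proof -
  have "acceleration \<gamma> s = norm (acceleration \<gamma> s) *\<^sub>R normal \<gamma> s"
    using curved[of s] by (simp add: normal_def)
  then have "acceleration \<gamma> s \<bullet> tube_normal \<gamma> s \<theta> = norm (acceleration \<gamma> s) * (normal \<gamma> s \<bullet> tube_normal \<gamma> s \<theta>)"
    by (metis inner_scaleR_left)
  then show ?thesis
    by (simp add: tube_normal_def inner_add_right normal_inner_self normal_binormal)
qed

text \<open>As \<open>b = \<gamma>' \<times> n\<close>, a vector orthogonal to \<open>\<gamma>'\<close> and \<open>n\<close> has zero cross product with \<open>b\<close>, hence is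
  parallel to \<open>b\<close>.\<close>

lemma orthogonal_to_frame_eq_0:
  assumes "w \<bullet> velocity \<gamma> s = 0" "w \<bullet> normal \<gamma> s = 0" "w \<bullet> binormal \<gamma> s = 0"
  shows "w = 0"
proof -
  have "cross3 w (binormal \<gamma> s) = 0"
    using assms(1,2) by (simp add: binormal_def Lagrange)
  then show ?thesis
    using norm_and_cross_eq_0[of w "binormal \<gamma> s"] assms(3) binormal_inner_self[of s] by auto
qed

lemma orthogonal_to_normal_plane:
  assumes "w \<bullet> normal \<gamma> s = 0" "w \<bullet> binormal \<gamma> s = 0"
  shows "w = (w \<bullet> velocity \<gamma> s) *\<^sub>R velocity \<gamma> s"
  using orthogonal_to_frame_eq_0[of "w - (w \<bullet> velocity \<gamma> s) *\<^sub>R velocity \<gamma> s" s] assms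
  by (simp add: inner_diff_left velocity_inner_self velocity_normal velocity_binormal)

lemma orthogonal_to_binormal:
  assumes "w \<bullet> binormal \<gamma> s = 0"
  shows "w = (w \<bullet> velocity \<gamma> s) *\<^sub>R velocity \<gamma> s + (w \<bullet> normal \<gamma> s) *\<^sub>R normal \<gamma> s"
  using orthogonal_to_frame_eq_0[of "w - ((w \<bullet> velocity \<gamma> s) *\<^sub>R velocity \<gamma> s + (w \<bullet> normal \<gamma> s) *\<^sub>R normal \<gamma> s)" s] assms
  by (simp add: inner_diff_left inner_add_left velocity_inner_self normal_inner_self velocity_normal
      velocity_binormal normal_binormal inner_commute[of "normal \<gamma> s" "velocity \<gamma> s"])

section \<open>The height of a chord over the tangent plane of the tube\<close>

text \<open>The value of \<open>F\<^sub>1\<close> at \<open>\<epsilon> = 0\<close>; with the endpoints exchanged, of \<open>-F\<^sub>2\<close>.\<close>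

definition height :: "real \<Rightarrow> real \<Rightarrow> real \<Rightarrow> real" where
  "height s \<theta> s' = (\<gamma> s' - \<gamma> s) \<bullet> tube_normal \<gamma> s \<theta>"

text \<open>This is \<open>\<partial>v/\<partial>\<theta>\<close>.\<close>

definition normal_turn :: "real \<Rightarrow> real \<Rightarrow> real ^ 3" where
  "normal_turn s \<theta> = - sin \<theta> *\<^sub>R normal \<gamma> s + cos \<theta> *\<^sub>R binormal \<gamma> s"

definition normal_shift :: "real \<Rightarrow> real \<Rightarrow> real ^ 3" where
  "normal_shift s \<theta> = vector_derivative (\<lambda>s. tube_normal \<gamma> s \<theta>) (at s)"

lemma has_vector_derivative_normal_turn:
  "((\<lambda>\<theta>. tube_normal \<gamma> s \<theta>) has_vector_derivative normal_turn s \<theta>) (at \<theta>)"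
  unfolding tube_normal_def normal_turn_def
  by (auto intro!: derivative_eq_intros)

lemma has_vector_derivative_normal_shift:
  "((\<lambda>s. tube_normal \<gamma> s \<theta>) has_vector_derivative normal_shift s \<theta>) (at s)"
  unfolding normal_shift_def
  by (rule has_vector_derivative_smooth) (intro smooth_tube_normal smooth_intros open_UNIV)

text \<open>Differentiating \<open>\<langle>\<gamma>', v\<rangle> = 0\<close> along the curve trades the derivative of \<open>v\<close> for the curvature.\<close>

lemma velocity_normal_shift:
  "velocity \<gamma> s \<bullet> normal_shift s \<theta> = - cos \<theta> * norm (acceleration \<gamma> s)"
  using inner_derivative_eq_0[OF has_vector_derivative_velocity has_vector_derivative_normal_shift velocity_tube_normal]
  by (simp add: acceleration_tube_normal eq_neg_iff_add_eq_0)

text \<open>The vectors \<open>v(s, \<theta>)\<close> and \<open>\<partial>v/\<partial>\<theta>\<close> form an orthonormal basis of the normal plane at \<open>s\<close>.\<close>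

lemma height_eq_0_imp_tangent:
  assumes "height s \<theta> s' = 0" "(\<gamma> s' - \<gamma> s) \<bullet> normal_turn s \<theta> = 0"
  shows "\<gamma> s' \<in> tangent_line \<gamma> s"
proof -
  let ?n = "(\<gamma> s' - \<gamma> s) \<bullet> normal \<gamma> s" and ?b = "(\<gamma> s' - \<gamma> s) \<bullet> binormal \<gamma> s"
  have 1: "cos \<theta> * ?n + sin \<theta> * ?b = 0" and 2: "- sin \<theta> * ?n + cos \<theta> * ?b = 0"
    using assms by (simp_all add: height_def tube_normal_def normal_turn_def inner_add_right inner_diff_right)
  have "((cos \<theta>)\<^sup>2 + (sin \<theta>)\<^sup>2) * ?n = 0"
    using 1 2 by algebra
  then have n: "?n = 0" by simp
  have "((cos \<theta>)\<^sup>2 + (sin \<theta>)\<^sup>2) * ?b = 0"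
    using 1 2 by algebra
  then have b: "?b = 0" by simp
  have "\<gamma> s' = \<gamma> s + ((\<gamma> s' - \<gamma> s) \<bullet> velocity \<gamma> s) *\<^sub>R velocity \<gamma> s"
    using orthogonal_to_normal_plane[OF n b] by (simp add: algebra_simps)
  then show ?thesis
    unfolding tangent_line_def by blast
qed

text \<open>This is where curvature and the osculating plane enter. Along a tangent chord the first product
  is a nonzero multiple of \<open>\<kappa> cos \<theta>\<close>. If it vanishes, \<open>v = \<plusminus>b(s)\<close>, and a second vanishing product
  would put the direction at \<open>s'\<close>, hence the tangent line there, into the osculating plane at \<open>s\<close>.\<close>

lemma tangent_chord_nondegenerate:
  assumes "\<gamma> s' \<in> tangent_line \<gamma> s" "\<gamma> s' \<noteq> \<gamma> s"
    and "\<not> tangent_line \<gamma> s' \<subseteq> osculating_plane \<gamma> s"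
  shows "(\<gamma> s' - \<gamma> s) \<bullet> normal_shift s \<theta> \<noteq> 0 \<or> velocity \<gamma> s' \<bullet> tube_normal \<gamma> s \<theta> \<noteq> 0"
proof (rule ccontr)
  assume contra: "\<not> ?thesis"
  obtain l where l: "\<gamma> s' = \<gamma> s + l *\<^sub>R velocity \<gamma> s"
    using assms(1) by (auto simp: tangent_line_def)
  with assms(2) have "l \<noteq> 0" by auto
  then have cos: "cos \<theta> = 0"
    using contra l velocity_normal_shift[of s \<theta>] curved[of s] by simp
  then have "sin \<theta> \<noteq> 0"
    using sin_cos_squared_add[of \<theta>] by auto
  then have "velocity \<gamma> s' \<bullet> binormal \<gamma> s = 0"
    using contra cos by (simp add: tube_normal_def)
  from orthogonal_to_binormal[OF this] obtain p q where pq: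
      "velocity \<gamma> s' = p *\<^sub>R velocity \<gamma> s + q *\<^sub>R acceleration \<gamma> s"
    unfolding normal_def by (metis scaleR_scaleR)
  have "tangent_line \<gamma> s' \<subseteq> osculating_plane \<gamma> s"
  proof
    fix x assume "x \<in> tangent_line \<gamma> s'"
    then obtain a where "x = \<gamma> s' + a *\<^sub>R velocity \<gamma> s'"
      by (auto simp: tangent_line_def)
    then have "x = \<gamma> s + (l + a * p) *\<^sub>R velocity \<gamma> s + (a * q) *\<^sub>R acceleration \<gamma> s"
      by (simp add: l pq algebra_simps)
    then show "x \<in> osculating_plane \<gamma> s"
      unfolding osculating_plane_def by blast
  qed
  then show False using assms(3) by blast
qed

lemma smooth_height:
  assumes "open S" "smooth_on S f" "smooth_on S g" "smooth_on S h"
  shows "smooth_on S (\<lambda>x. height (f x) (g x) (h x))"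
  unfolding height_def
  by (intro smooth_intros smooth_tube_normal assms smooth_on_compose_UNIV[of S \<gamma>] smooth)

text \<open>The derivative in the direction of \<open>s\<close> has no contribution from the moving base point, since
  \<open>\<gamma>'\<close> is orthogonal to \<open>v\<close>.\<close>

lemma grad_height:
  fixes x :: "real ^ 'n"
  assumes "i \<noteq> j" "i \<noteq> k" "j \<noteq> k"
  defines "f \<equiv> \<lambda>x. height (x $ i) (x $ j) (x $ k)"
  shows "grad f x $ i = (\<gamma> (x $ k) - \<gamma> (x $ i)) \<bullet> normal_shift (x $ i) (x $ j)"
    and "grad f x $ j = (\<gamma> (x $ k) - \<gamma> (x $ i)) \<bullet> normal_turn (x $ i) (x $ j)"
    and "grad f x $ k = velocity \<gamma> (x $ k) \<bullet> tube_normal \<gamma> (x $ i) (x $ j)"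
    and "m \<notin> {i, j, k} \<Longrightarrow> grad f x $ m = 0"
proof -
  have smooth_f: "smooth_on UNIV f"
    unfolding f_def by (intro smooth_height smooth_intros open_UNIV)
  have axis: "(x + (t - x $ l) *\<^sub>R axis l 1) $ m = (if m = l then t else x $ m)" for t l m
    by (simp add: axis_def)
  show "grad f x $ i = (\<gamma> (x $ k) - \<gamma> (x $ i)) \<bullet> normal_shift (x $ i) (x $ j)"
  proof (rule grad_nth_eqI[OF smooth_f])
    have "((\<lambda>s. \<gamma> (x $ k) - \<gamma> s) has_vector_derivative - velocity \<gamma> (x $ i)) (at (x $ i))"
      using has_vector_derivative_diff[OF has_vector_derivative_const[of "\<gamma> (x $ k)"] has_vector_derivative_curve[of "x $ i"]] by simp
    from has_real_derivative_inner[OF this has_vector_derivative_normal_shift[of "x $ j"]]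
    show "((\<lambda>t. f (x + (t - x $ i) *\<^sub>R axis i 1)) has_real_derivative
        (\<gamma> (x $ k) - \<gamma> (x $ i)) \<bullet> normal_shift (x $ i) (x $ j)) (at (x $ i))"
      unfolding f_def axis using assms(1-3) by (simp add: height_def velocity_tube_normal)
  qed
  show "grad f x $ j = (\<gamma> (x $ k) - \<gamma> (x $ i)) \<bullet> normal_turn (x $ i) (x $ j)"
  proof (rule grad_nth_eqI[OF smooth_f])
    from has_real_derivative_inner[OF has_vector_derivative_const has_vector_derivative_normal_turn]
    show "((\<lambda>t. f (x + (t - x $ j) *\<^sub>R axis j 1)) has_real_derivative
        (\<gamma> (x $ k) - \<gamma> (x $ i)) \<bullet> normal_turn (x $ i) (x $ j)) (at (x $ j))"
      unfolding f_def axis using assms(1-3) by (simp add: height_def)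
  qed
  show "grad f x $ k = velocity \<gamma> (x $ k) \<bullet> tube_normal \<gamma> (x $ i) (x $ j)"
  proof (rule grad_nth_eqI[OF smooth_f])
    have "((\<lambda>s. \<gamma> s - \<gamma> (x $ i)) has_vector_derivative velocity \<gamma> (x $ k)) (at (x $ k))"
      using has_vector_derivative_diff[OF has_vector_derivative_curve[of "x $ k"] has_vector_derivative_const[of "\<gamma> (x $ i)"]] by simp
    from has_real_derivative_inner[OF this has_vector_derivative_const]
    show "((\<lambda>t. f (x + (t - x $ k) *\<^sub>R axis k 1)) has_real_derivative
        velocity \<gamma> (x $ k) \<bullet> tube_normal \<gamma> (x $ i) (x $ j)) (at (x $ k))"
      unfolding f_def axis using assms(1-3) by (simp add: height_def)
  qed
  assume m: "m \<notin> {i, j, k}"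
  show "grad f x $ m = 0"
  proof (rule grad_nth_eqI[OF smooth_f])
    show "((\<lambda>t. f (x + (t - x $ m) *\<^sub>R axis m 1)) has_real_derivative 0) (at (x $ m))"
      using m unfolding f_def axis by (simp add: eq_commute[of _ m])
  qed
qed

lemma F1_eq: "F1 \<gamma> \<epsilon> s1 \<theta>1 s2 \<theta>2 = height s1 \<theta>1 s2 + \<epsilon> * (tube_normal \<gamma> s2 \<theta>2 \<bullet> tube_normal \<gamma> s1 \<theta>1 - 1)"
  by (simp add: F1_def tube_def height_def inner_diff_left inner_add_left tube_normal_inner_self algebra_simps)

lemma F2_eq: "F2 \<gamma> \<epsilon> s1 \<theta>1 s2 \<theta>2 = - height s2 \<theta>2 s1 + \<epsilon> * (1 - tube_normal \<gamma> s2 \<theta>2 \<bullet> tube_normal \<gamma> s1 \<theta>1)"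
  by (simp add: F2_def tube_def height_def inner_diff_left inner_add_left tube_normal_inner_self
      inner_commute[of "tube_normal \<gamma> s1 \<theta>1"] algebra_simps)

end

section \<open>The flat distance\<close>

text \<open>Among the translates of \<open>u\<close> by multiples of \<open>T\<close>, the two around zero are the nearest to zero.\<close>

lemma circle_gap:
  fixes u T :: real and m k :: int
  assumes "0 \<le> u - of_int m * T" "u - of_int m * T \<le> T"
  shows "min (u - of_int m * T) (of_int (m + 1) * T - u) \<le> \<bar>u + of_int k * T\<bar>"
proof -
  have T: "0 \<le> T" using assms by linarith
  consider "k \<ge> - m" | "k \<le> - m - 1" by linarith
  then show ?thesis
  proof cases
    case 1
    then have "of_int (- m) * T \<le> of_int k * T"
      using T by (intro mult_right_mono) auto
    then show ?thesis using assms by simp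
  next
    case 2
    then have "of_int k * T \<le> of_int (- m - 1) * T"
      using T by (intro mult_right_mono) auto
    then show ?thesis using assms by (simp add: algebra_simps)
  qed
qed

lemma floor_div_mult:
  fixes u T :: real
  assumes "T > 0"
  shows "0 \<le> u - of_int \<lfloor>u / T\<rfloor> * T" "u - of_int \<lfloor>u / T\<rfloor> * T < T"
proof -
  have "of_int \<lfloor>u / T\<rfloor> * T \<le> u / T * T"
    using assms by (intro mult_right_mono) auto
  then show "0 \<le> u - of_int \<lfloor>u / T\<rfloor> * T" using assms by simp
  have "u / T * T < (of_int \<lfloor>u / T\<rfloor> + 1) * T"
    using assms by (intro mult_strict_right_mono) linarith+
  then show "u - of_int \<lfloor>u / T\<rfloor> * T < T" using assms by (simp add: algebra_simps)
qed

lemma circle_dist_less_iff: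
  "circle_dist (circle_class T s) (circle_class T t) < \<delta> \<longleftrightarrow> (\<exists>k :: int. \<bar>t - s + of_int k * T\<bar> < \<delta>)"
  using le_circle_dist_iff[of \<delta> T s t] by (auto simp: not_le[symmetric])

lemma circle_dist_le:
  "circle_dist (circle_class T s) (circle_class T t) \<le> \<bar>t - s + of_int k * T\<bar>"
  using le_circle_dist_iff[of "circle_dist (circle_class T s) (circle_class T t)" T s t] by blast

lemma circle_dist_commute: "circle_dist a b = circle_dist b a"
  by (simp add: circle_dist_def setdist_sym)

lemma circle_dist_self [simp]: "circle_dist a a = 0"
  unfolding circle_dist_def using setdist_le_dist[of _ a _ a]
  by (metis all_not_in_conv antisym dist_self setdist_empty1 setdist_pos_le)

lemma circle_dist_triangle_less:
  assumes "a \<in> range (circle_class T)" "b \<in> range (circle_class T)" "c \<in> range (circle_class T)"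
    and "circle_dist a b < d" "circle_dist b c < e"
  shows "circle_dist a c < d + e"
proof -
  obtain r s t where "a = circle_class T r" "b = circle_class T s" "c = circle_class T t"
    using assms(1-3) by blast
  with assms(4,5) obtain k l :: int where k: "\<bar>s - r + of_int k * T\<bar> < d"
      and l: "\<bar>t - s + of_int l * T\<bar> < e" and abc: "a = circle_class T r" "c = circle_class T t"
    by (auto simp: circle_dist_less_iff)
  have "\<bar>t - r + of_int (k + l) * T\<bar> < d + e"
    using k l by (simp add: distrib_right)
  then show ?thesis
    unfolding abc circle_dist_less_iff by blast
qed

lemma circle_dist_pos:
  assumes "T > 0" "a \<in> range (circle_class T)" "b \<in> range (circle_class T)" "a \<noteq> b"
  shows "0 < circle_dist a b"
proof -
  obtain s t where st: "a = circle_class T s" "b = circle_class T t"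
    using assms(2,3) by blast
  define m where "m = \<lfloor>(t - s) / T\<rfloor>"
  let ?r = "(t - s) - of_int m * T"
  have r: "0 \<le> ?r" "?r < T" using floor_div_mult[OF assms(1), of "t - s"] by (simp_all add: m_def)
  have "?r \<noteq> 0"
  proof
    assume "?r = 0"
    then have "t = s + of_int m * T" by simp
    then have "a = b" unfolding st circle_class_eq_iff by blast
    then show False using assms(4) by simp
  qed
  then have "0 < min ?r (of_int (m + 1) * T - (t - s))"
    using r by (simp add: algebra_simps)
  also have "\<dots> \<le> circle_dist a b"
    unfolding st le_circle_dist_iff using circle_gap r by (meson less_imp_le)
  finally show ?thesis .
qed

text \<open>Of the two boundary components of the band around the diagonal, at most one is near a given
  point, since \<open>\<delta> < T / 2\<close>. Near the point the complement of the band is thus defined by one affine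
  inequality. The number \<open>u0\<close> stands for \<open>s\<^sub>2 - s\<^sub>1\<close>.\<close>

lemma off_diagonal_locally_half_space:
  fixes T \<delta> u0 :: real
  assumes "0 < \<delta>" "\<delta> < T / 2" "\<And>k :: int. \<delta> \<le> \<bar>u0 + of_int k * T\<bar>"
  obtains \<sigma> w r :: real where "\<sigma> \<noteq> 0" "r > 0"
    "\<And>u. \<bar>u - u0\<bar> < r \<Longrightarrow> (\<forall>k :: int. \<delta> \<le> \<bar>u + of_int k * T\<bar>) \<longleftrightarrow> 0 \<le> \<sigma> * u + w"
    "\<sigma> * u0 + w = 0 \<Longrightarrow> \<exists>k :: int. \<bar>u0 + of_int k * T\<bar> = \<delta>"
proof -
  have T: "T > 0" using assms(1,2) by linarith
  define m where "m = \<lfloor>u0 / T\<rfloor>"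
  have r0: "0 \<le> u0 - of_int m * T" "u0 - of_int m * T < T"
    using floor_div_mult[OF T, of u0] by (simp_all add: m_def)
  have lo: "\<delta> \<le> u0 - of_int m * T"
    using assms(3)[of "- m"] r0 by simp
  have hi: "\<delta> \<le> of_int (m + 1) * T - u0"
    using assms(3)[of "- m - 1"] r0 by (simp add: algebra_simps)
  have strip: "(\<forall>k :: int. \<delta> \<le> \<bar>u + of_int k * T\<bar>) \<longleftrightarrow> \<delta> \<le> u - of_int m * T \<and> \<delta> \<le> of_int (m + 1) * T - u"
    if u: "0 \<le> u - of_int m * T" "u - of_int m * T \<le> T" for u
  proof
    assume "\<forall>k :: int. \<delta> \<le> \<bar>u + of_int k * T\<bar>"
    from spec[OF this, of "- m"] spec[OF this, of "- m - 1"]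
    show "\<delta> \<le> u - of_int m * T \<and> \<delta> \<le> of_int (m + 1) * T - u"
      using u by (simp add: algebra_simps)
  next
    assume "\<delta> \<le> u - of_int m * T \<and> \<delta> \<le> of_int (m + 1) * T - u"
    then show "\<forall>k :: int. \<delta> \<le> \<bar>u + of_int k * T\<bar>"
      using circle_gap[OF u] by (meson min.boundedI order_trans)
  qed
  show ?thesis
  \<comment> \<open>The endpoint of the interval \<open>[mT, (m + 1)T]\<close> that is nearer to \<open>u0\<close> gives the inequality.\<close>
  proof (cases "u0 - of_int m * T \<le> T / 2")
    case True
    show ?thesis
    proof (rule that[of 1 "min \<delta> (T / 2 - \<delta>)" "- (of_int m * T) - \<delta>"])
      fix u assume "\<bar>u - u0\<bar> < min \<delta> (T / 2 - \<delta>)"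
      then have "u < u0 + (T / 2 - \<delta>)" "u0 < u + \<delta>"
        by (auto simp: abs_less_iff)
      then have "0 \<le> u - of_int m * T" "u - of_int m * T \<le> T" "\<delta> \<le> of_int (m + 1) * T - u"
        using True lo assms(1) distrib_right[of "of_int m" 1 T] by auto
      then show "(\<forall>k :: int. \<delta> \<le> \<bar>u + of_int k * T\<bar>) \<longleftrightarrow> 0 \<le> 1 * u + (- (of_int m * T) - \<delta>)"
        using strip by auto
    next
      assume "1 * u0 + (- (of_int m * T) - \<delta>) = 0"
      then show "\<exists>k :: int. \<bar>u0 + of_int k * T\<bar> = \<delta>"
        using assms(1) by (intro exI[of _ "- m"]) simp
    qed (use assms in auto)
  next
    case False
    show ?thesis
    proof (rule that[of "- 1" "min \<delta> (T / 2 - \<delta>)" "of_int (m + 1) * T - \<delta>"])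
      fix u assume "\<bar>u - u0\<bar> < min \<delta> (T / 2 - \<delta>)"
      then have "u < u0 + \<delta>" "u0 < u + (T / 2 - \<delta>)"
        by (auto simp: abs_less_iff)
      then have "0 \<le> u - of_int m * T" "u - of_int m * T \<le> T" "\<delta> \<le> u - of_int m * T"
        using False hi assms(1) distrib_right[of "of_int m" 1 T] by auto
      then show "(\<forall>k :: int. \<delta> \<le> \<bar>u + of_int k * T\<bar>) \<longleftrightarrow> 0 \<le> - 1 * u + (of_int (m + 1) * T - \<delta>)"
        using strip by auto
    next
      assume "- 1 * u0 + (of_int (m + 1) * T - \<delta>) = 0"
      then show "\<exists>k :: int. \<bar>u0 + of_int k * T\<bar> = \<delta>"
        using assms(1) by (intro exI[of _ "- m - 1"]) (simp add: algebra_simps)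
    qed (use assms in auto)
  qed
qed

section \<open>Small squares around the special pairs\<close>

lemma special_pairs_range:
  assumes "c \<in> special_pairs \<gamma> T"
  shows "fst c \<in> range (circle_class T)" "snd c \<in> range (circle_class T)" "fst c \<noteq> snd c"
  using assms by (auto simp: special_pairs_def first_special_def second_special_def)

text \<open>A point common to the band and to a square has its centre within \<open>3\<delta>\<close> of the diagonal, and the
  centres of two squares that meet are within \<open>2\<delta>\<close> in both coordinates. Finitely many positive
  distances bound \<open>\<delta>\<close>.\<close>

lemma small_delta_admissible:
  assumes "T > 0" "finite (special_pairs \<gamma> T)"
  shows "\<exists>\<delta>0>0. \<forall>\<delta>. 0 < \<delta> \<and> \<delta> < \<delta>0 \<longrightarrow> admissible_delta \<gamma> T \<delta>"
proof -
  let ?S = "special_pairs \<gamma> T"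
  let ?sep = "\<lambda>c d. max (circle_dist (fst c) (fst d)) (circle_dist (snd c) (snd d))"
  \<comment> \<open>All upper bounds that \<open>\<delta>\<close> has to respect.\<close>
  define D where "D = insert (T / 2) ((\<lambda>c. circle_dist (fst c) (snd c) / 3) ` ?S \<union>
    (\<lambda>(c, d). ?sep c d / 2) ` {(c, d). c \<in> ?S \<and> d \<in> ?S \<and> c \<noteq> d})"
  have "finite {(c, d). c \<in> ?S \<and> d \<in> ?S \<and> c \<noteq> d}"
    by (rule finite_subset[of _ "?S \<times> ?S"]) (use assms(2) in auto)
  then have fin: "finite D" using assms(2) by (simp add: D_def)
  have "0 < x" if "x \<in> D" for x
  proof -
    have "0 < ?sep c d" if "c \<in> ?S" "d \<in> ?S" "c \<noteq> d" for c d
      using that special_pairs_range circle_dist_pos[OF assms(1)]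
      by (cases "fst c = fst d") (auto simp: less_max_iff_disj prod_eq_iff)
    moreover have "0 < circle_dist (fst c) (snd c)" if "c \<in> ?S" for c
      using special_pairs_range[OF that] circle_dist_pos[OF assms(1)] by blast
    ultimately show ?thesis
      using that assms(1) unfolding D_def by fastforce
  qed
  moreover have "D \<noteq> {}" by (simp add: D_def)
  ultimately have pos: "0 < Min D" using fin by simp
  have le: "Min D \<le> x" if "x \<in> D" for x using fin that by simp
  have "admissible_delta \<gamma> T \<delta>" if \<delta>: "0 < \<delta>" "\<delta> < Min D" for \<delta>
    unfolding admissible_delta_def
  proof (intro conjI ballI pairwiseI)
    show "\<delta> < T / 2" using \<delta> le[of "T / 2"] by (simp add: D_def)
  next
    fix c assume c: "c \<in> ?S"
    show "disjnt (diagonal_band T \<delta>) (closed_square T \<delta> c)"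
      unfolding disjnt_iff
    proof (intro allI notI)
      fix p assume p: "p \<in> diagonal_band T \<delta> \<and> p \<in> closed_square T \<delta> c"
      obtain a b where "p = (a, b)" by (cases p)
      with p have "a \<in> range (circle_class T) \<and> b \<in> range (circle_class T) \<and>
          circle_dist a b \<le> \<delta> \<and> circle_dist a (fst c) \<le> \<delta> \<and> circle_dist b (snd c) \<le> \<delta>"
        by (simp add: diagonal_band_def closed_square_def)
      then have ab: "a \<in> range (circle_class T)" "b \<in> range (circle_class T)"
          "circle_dist a b < Min D" "circle_dist a (fst c) < Min D" "circle_dist b (snd c) < Min D"
        using \<delta>(2) by linarith+
      have "circle_dist a (snd c) < Min D + Min D"
        using circle_dist_triangle_less[OF ab(1,2) special_pairs_range(2)[OF c] ab(3,5)] .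
      then have "circle_dist (fst c) (snd c) < Min D + (Min D + Min D)"
        using circle_dist_triangle_less[OF special_pairs_range(1)[OF c] ab(1) special_pairs_range(2)[OF c]]
          ab(4) circle_dist_commute[of a] by metis
      moreover have "Min D \<le> circle_dist (fst c) (snd c) / 3"
        using c by (intro le) (auto simp: D_def)
      ultimately show False by linarith
    qed
  next
    fix c d assume cd: "c \<in> ?S" "d \<in> ?S" "c \<noteq> d"
    show "disjnt (closed_square T \<delta> c) (closed_square T \<delta> d)"
      unfolding disjnt_iff
    proof (intro allI notI)
      fix p assume p: "p \<in> closed_square T \<delta> c \<and> p \<in> closed_square T \<delta> d"
      obtain a b where "p = (a, b)" by (cases p)
      with p have "a \<in> range (circle_class T) \<and> b \<in> range (circle_class T) \<and>
          circle_dist a (fst c) \<le> \<delta> \<and> circle_dist b (snd c) \<le> \<delta> \<and>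
          circle_dist a (fst d) \<le> \<delta> \<and> circle_dist b (snd d) \<le> \<delta>"
        by (simp add: closed_square_def)
      then have ab: "a \<in> range (circle_class T)" "b \<in> range (circle_class T)"
          "circle_dist (fst c) a < Min D" "circle_dist (snd c) b < Min D"
          "circle_dist a (fst d) < Min D" "circle_dist b (snd d) < Min D"
        using \<delta>(2) circle_dist_commute[of a "fst c"] circle_dist_commute[of b "snd c"] by linarith+
      have "?sep c d < Min D + Min D"
        using circle_dist_triangle_less[OF special_pairs_range(1)[OF cd(1)] ab(1) special_pairs_range(1)[OF cd(2)] ab(3,5)]
          circle_dist_triangle_less[OF special_pairs_range(2)[OF cd(1)] ab(2) special_pairs_range(2)[OF cd(2)] ab(4,6)]
        by simp
      moreover have "Min D \<le> ?sep c d / 2"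
        using cd by (intro le) (force simp: D_def)
      ultimately show False by linarith
    qed
  qed (use \<delta> in auto)
  then show ?thesis using pos by blast
qed

section \<open>Transversality for thin tubes\<close>

lemma generic_knot_frenet_curve: "generic_knot \<gamma> T \<Longrightarrow> frenet_curve \<gamma>"
  by unfold_locales (auto simp: generic_knot_def smooth_knot_def curvature_def)

lemma second_special_swap: "second_special \<gamma> T s1 s2 \<longleftrightarrow> first_special \<gamma> T s2 s1"
  by (auto simp: first_special_def second_special_def)

text \<open>Both tangent lines would be the line through the two points, but distinct points of the knot
  have distinct tangent lines.\<close>

lemma not_first_and_second_special:
  assumes "generic_knot \<gamma> T" "first_special \<gamma> T s1 s2" "second_special \<gamma> T s1 s2"
  shows False
proof -
  have ne: "circle_class T s1 \<noteq> circle_class T s2"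
    using assms(2) by (simp add: first_special_def)
  then have ne': "\<gamma> s1 \<noteq> \<gamma> s2"
    using assms(1) by (simp add: generic_knot_def smooth_knot_def)
  obtain a where a: "\<gamma> s2 = \<gamma> s1 + a *\<^sub>R velocity \<gamma> s1"
    using assms(2) by (auto simp: first_special_def tangent_line_def)
  obtain b where b: "\<gamma> s1 = \<gamma> s2 + b *\<^sub>R velocity \<gamma> s2"
    using assms(3) by (auto simp: second_special_def tangent_line_def)
  have ab: "a \<noteq> 0" "b \<noteq> 0" using a b ne' by auto
  have "\<gamma> s1 = (\<gamma> s1 + a *\<^sub>R velocity \<gamma> s1) + b *\<^sub>R velocity \<gamma> s2"
    unfolding a[symmetric] by (rule b)
  then have "a *\<^sub>R velocity \<gamma> s1 + b *\<^sub>R velocity \<gamma> s2 = 0"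
    by (simp add: add.assoc)
  then have opp: "a *\<^sub>R velocity \<gamma> s1 = - (b *\<^sub>R velocity \<gamma> s2)" "b *\<^sub>R velocity \<gamma> s2 = - (a *\<^sub>R velocity \<gamma> s1)"
    by (simp_all add: eq_neg_iff_add_eq_0 add.commute)
  have v: "velocity \<gamma> s1 = (- b / a) *\<^sub>R velocity \<gamma> s2" "velocity \<gamma> s2 = (- a / b) *\<^sub>R velocity \<gamma> s1"
    using arg_cong[OF opp(1), of "(*\<^sub>R) (1 / a)"] arg_cong[OF opp(2), of "(*\<^sub>R) (1 / b)"] ab by simp_all
  have "tangent_line \<gamma> s1 = tangent_line \<gamma> s2"
  proof
    show "tangent_line \<gamma> s1 \<subseteq> tangent_line \<gamma> s2"
    proof
      fix x assume "x \<in> tangent_line \<gamma> s1"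
      then obtain t where t: "x = \<gamma> s1 + t *\<^sub>R velocity \<gamma> s1" by (auto simp: tangent_line_def)
      have "x = (\<gamma> s2 + b *\<^sub>R velocity \<gamma> s2) + t *\<^sub>R ((- b / a) *\<^sub>R velocity \<gamma> s2)"
        by (metis t b v(1))
      then have "x = \<gamma> s2 + (b + t * (- b / a)) *\<^sub>R velocity \<gamma> s2"
        by (simp add: scaleR_left_distrib scaleR_left_diff_distrib)
      then show "x \<in> tangent_line \<gamma> s2" unfolding tangent_line_def by blast
    qed
    show "tangent_line \<gamma> s2 \<subseteq> tangent_line \<gamma> s1"
    proof
      fix x assume "x \<in> tangent_line \<gamma> s2"
      then obtain t where t: "x = \<gamma> s2 + t *\<^sub>R velocity \<gamma> s2" by (auto simp: tangent_line_def)
      have "x = (\<gamma> s1 + a *\<^sub>R velocity \<gamma> s1) + t *\<^sub>R ((- a / b) *\<^sub>R velocity \<gamma> s1)"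
        by (metis t a v(2))
      then have "x = \<gamma> s1 + (a + t * (- a / b)) *\<^sub>R velocity \<gamma> s1"
        by (simp add: scaleR_left_distrib scaleR_left_diff_distrib)
      then show "x \<in> tangent_line \<gamma> s1" unfolding tangent_line_def by blast
    qed
  qed
  then show False
    using assms(1) ne by (auto simp: generic_knot_def)
qed

text \<open>A special pair lies in the square around itself, which is disjoint from the band.\<close>

lemma special_pair_far_from_diagonal:
  assumes "admissible_delta \<gamma> T \<delta>" "first_special \<gamma> T s1 s2 \<or> second_special \<gamma> T s1 s2"
  shows "\<delta> < \<bar>s2 - s1 + of_int k * T\<bar>"
proof -
  let ?c = "(circle_class T s1, circle_class T s2)"
  have "?c \<in> special_pairs \<gamma> T"
    using assms(2) by (auto simp: special_pairs_def)
  then have "disjnt (diagonal_band T \<delta>) (closed_square T \<delta> ?c)" "0 < \<delta>"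
    using assms(1) by (auto simp: admissible_delta_def)
  moreover have "?c \<in> closed_square T \<delta> ?c"
    using \<open>0 < \<delta>\<close> by (simp add: closed_square_def)
  ultimately have "?c \<notin> diagonal_band T \<delta>" by (auto simp: disjnt_iff)
  then have "\<delta> < circle_dist (circle_class T s1) (circle_class T s2)"
    by (simp add: diagonal_band_def)
  also have "\<dots> \<le> \<bar>s2 - s1 + of_int k * T\<bar>" by (rule circle_dist_le)
  finally show ?thesis .
qed

text \<open>Here \<open>p\<close>, \<open>q\<close>, \<open>r\<close> are the gradients of \<open>F\<^sub>1\<close>, \<open>-F\<^sub>2\<close>, \<open>G\<close> at \<open>\<epsilon> = 0\<close> in the coordinates
  \<open>(s\<^sub>1, \<theta>\<^sub>1, s\<^sub>2, \<theta>\<^sub>2)\<close>, and a nonzero coefficient can only belong to an active constraint. The second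
  and fourth components isolate \<open>p\<close> and \<open>q\<close>. For an active \<open>F\<^sub>1\<close> the case \<open>p $ 2 = 0\<close> is that of
  an \<open>s\<^sub>1\<close>-special pair, for an active \<open>F\<^sub>2\<close> the case \<open>q $ 4 = 0\<close> that of an \<open>s\<^sub>2\<close>-special pair; in
  either case \<open>G\<close> is inactive and the other angular derivative is available.\<close>

lemma independent_constraint_gradients:
  fixes p q r :: "real ^ 4"
  assumes "c1 *\<^sub>R p + c2 *\<^sub>R q + c3 *\<^sub>R r = 0"
    and "p $ 4 = 0" "q $ 2 = 0" "r $ 2 = 0" "r $ 4 = 0" "r \<noteq> 0"
    and "c1 \<noteq> 0 \<Longrightarrow> p \<noteq> 0" "c2 \<noteq> 0 \<Longrightarrow> q \<noteq> 0"
    and "c1 \<noteq> 0 \<Longrightarrow> p $ 2 = 0 \<Longrightarrow> c3 = 0 \<and> (c2 \<noteq> 0 \<longrightarrow> q $ 4 \<noteq> 0)"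
    and "c2 \<noteq> 0 \<Longrightarrow> q $ 4 = 0 \<Longrightarrow> c3 = 0 \<and> (c1 \<noteq> 0 \<longrightarrow> p $ 2 \<noteq> 0)"
  shows "c1 = 0 \<and> c2 = 0 \<and> c3 = 0"
proof -
  have "(c1 *\<^sub>R p + c2 *\<^sub>R q + c3 *\<^sub>R r) $ 2 = 0" "(c1 *\<^sub>R p + c2 *\<^sub>R q + c3 *\<^sub>R r) $ 4 = 0"
    by (simp_all only: assms(1) zero_index)
  then have 1: "c1 = 0 \<or> p $ 2 = 0" and 2: "c2 = 0 \<or> q $ 4 = 0"
    using assms(2-5) by simp_all
  have "c1 = 0"
  proof (rule ccontr)
    assume "c1 \<noteq> 0"
    then have "c2 = 0" "c3 = 0" using 1 2 assms(9) by auto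
    then show False using assms(1,7) \<open>c1 \<noteq> 0\<close> by simp
  qed
  moreover have "c2 = 0"
  proof (rule ccontr)
    assume "c2 \<noteq> 0"
    then have "c1 = 0" "c3 = 0" using 1 2 assms(10) by auto
    then show False using assms(1,8) \<open>c2 \<noteq> 0\<close> by simp
  qed
  ultimately show ?thesis using assms(1,6) by simp
qed

text \<open>The preimage in \<open>\<real>\<^sup>4\<close> of the outward-pointing chords off the diagonal.\<close>

definition lifted_chords :: "(real \<Rightarrow> real ^ 3) \<Rightarrow> real \<Rightarrow> real \<Rightarrow> real \<Rightarrow> (real ^ 4) set" where
  "lifted_chords \<gamma> T \<delta> \<epsilon> =
     {x. 0 \<le> F1 \<gamma> \<epsilon> (x $ 1) (x $ 2) (x $ 3) (x $ 4) \<and> 0 \<le> F2 \<gamma> \<epsilon> (x $ 1) (x $ 2) (x $ 3) (x $ 4) \<and>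
        (\<forall>k :: int. \<delta> \<le> \<bar>x $ 3 - x $ 1 + of_int k * T\<bar>)}"

context frenet_curve
begin

lemma first_special_grad_height:
  fixes x :: "real ^ 'n"
  assumes "generic_knot \<gamma> T" "i \<noteq> j" "i \<noteq> k" "j \<noteq> k" "circle_class T (x $ i) \<noteq> circle_class T (x $ k)"
  defines "f \<equiv> \<lambda>x. height (x $ i) (x $ j) (x $ k)"
  assumes "f x = 0" "grad f x $ j = 0"
  shows "first_special \<gamma> T (x $ i) (x $ k)" "grad f x \<noteq> 0"
proof -
  have tangent: "\<gamma> (x $ k) \<in> tangent_line \<gamma> (x $ i)"
    using height_eq_0_imp_tangent[of "x $ i" "x $ j" "x $ k"] grad_height(2)[OF assms(2-4)] assms(7,8)
    by (simp add: f_def)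
  then show special: "first_special \<gamma> T (x $ i) (x $ k)"
    using assms(5) by (simp add: first_special_def)
  have "\<gamma> (x $ k) \<noteq> \<gamma> (x $ i)"
    using assms(1,5) by (auto simp: generic_knot_def smooth_knot_def)
  then have "grad f x $ i \<noteq> 0 \<or> grad f x $ k \<noteq> 0"
    using tangent_chord_nondegenerate[OF tangent] special assms(1)
    unfolding f_def grad_height(1,3)[OF assms(2-4)]
    by (auto simp: generic_knot_def)
  then show "grad f x \<noteq> 0" by auto
qed

text \<open>Transversality at \<open>\<epsilon> = 0\<close>, together with its stability. The index \<open>1\<close> stands for \<open>F\<^sub>1\<close>, \<open>2\<close> for \<open>F\<^sub>2\<close>,
  \<open>3\<close> for the boundary of the band.\<close>

lemma lifted_chords_corner_point_near:
  fixes x0 :: "real ^ 4"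
  assumes generic: "generic_knot \<gamma> T" and adm: "admissible_delta \<gamma> T \<delta>"
    and off: "\<And>k :: int. \<delta> \<le> \<bar>x0 $ 3 - x0 $ 1 + of_int k * T\<bar>"
  shows "\<exists>\<eta>>0. \<forall>\<epsilon> x. \<bar>\<epsilon>\<bar> < \<eta> \<longrightarrow> x \<in> ball x0 \<eta> \<longrightarrow> x \<in> lifted_chords \<gamma> T \<delta> \<epsilon> \<longrightarrow>
      corner_point (lifted_chords \<gamma> T \<delta> \<epsilon>) x"
proof -
  have \<delta>: "0 < \<delta>" "\<delta> < T / 2" using adm by (simp_all add: admissible_delta_def)
  obtain \<sigma> w r :: real where \<sigma>: "\<sigma> \<noteq> 0" "r > 0"
    and half_space: "\<And>u. \<bar>u - (x0 $ 3 - x0 $ 1)\<bar> < r \<Longrightarrow>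
        (\<forall>k :: int. \<delta> \<le> \<bar>u + of_int k * T\<bar>) \<longleftrightarrow> 0 \<le> \<sigma> * u + w"
    and boundary: "\<sigma> * (x0 $ 3 - x0 $ 1) + w = 0 \<Longrightarrow> \<exists>k :: int. \<bar>x0 $ 3 - x0 $ 1 + of_int k * T\<bar> = \<delta>"
    using off_diagonal_locally_half_space[OF \<delta> off] by metis
  define h1 h2 g B :: "real ^ 4 \<Rightarrow> real" where "h1 = (\<lambda>x. height (x $ 1) (x $ 2) (x $ 3))"
    and "h2 = (\<lambda>x. height (x $ 3) (x $ 4) (x $ 1))" and "g = (\<lambda>x. \<sigma> * (x $ 3 - x $ 1) + w)"
    and "B = (\<lambda>x. tube_normal \<gamma> (x $ 3) (x $ 4) \<bullet> tube_normal \<gamma> (x $ 1) (x $ 2) - 1)"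
  have smooth: "smooth_on UNIV h1" "smooth_on UNIV h2" "smooth_on UNIV g" "smooth_on UNIV B"
    unfolding h1_def h2_def g_def B_def
    by (intro smooth_intros smooth_height smooth_tube_normal open_UNIV)+
  define a b :: "nat \<Rightarrow> real ^ 4 \<Rightarrow> real"
    where "a = (\<lambda>i. if i = 1 then h1 else if i = 2 then (\<lambda>x. - h2 x) else g)"
      and "b = (\<lambda>i. if i = 1 then B else if i = 2 then (\<lambda>x. - B x) else (\<lambda>_. 0))"
  let ?J = "{1, 2, 3 :: nat}"
  have ab: "(\<forall>i\<in>?J. 0 \<le> a i x + \<epsilon> * b i x) \<longleftrightarrow>
      0 \<le> F1 \<gamma> \<epsilon> (x $ 1) (x $ 2) (x $ 3) (x $ 4) \<and> 0 \<le> F2 \<gamma> \<epsilon> (x $ 1) (x $ 2) (x $ 3) (x $ 4) \<and> 0 \<le> g x" for x \<epsilon>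
    by (simp add: a_def b_def F1_eq F2_eq h1_def h2_def B_def algebra_simps)
  let ?p = "grad h1 x0" and ?q = "grad h2 x0"
  have grad_g: "grad g x0 = \<sigma> *\<^sub>R (axis 3 1 - axis 1 1)"
    unfolding g_def
    by (rule grad_eqI) (auto intro!: derivative_eq_intros bounded_linear_imp_has_derivative[OF bounded_linear_vec_nth] simp: inner_diff_left inner_commute[of "axis _ _"] inner_axis)
  have distinct: "circle_class T (x0 $ 1) \<noteq> circle_class T (x0 $ 3)"
  proof
    assume "circle_class T (x0 $ 1) = circle_class T (x0 $ 3)"
    then obtain k :: int where "x0 $ 3 = x0 $ 1 + of_int k * T"
      unfolding circle_class_eq_iff by blast
    then show False using off[of "- k"] \<delta>(1) by simp
  qed
  have first: "first_special \<gamma> T (x0 $ 1) (x0 $ 3)" "?p \<noteq> 0" if "h1 x0 = 0" "?p $ 2 = 0"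
    using first_special_grad_height[OF generic, of 1 2 3 x0] distinct that by (simp_all add: h1_def)
  have second: "second_special \<gamma> T (x0 $ 1) (x0 $ 3)" "?q \<noteq> 0" if "h2 x0 = 0" "?q $ 4 = 0"
    using first_special_grad_height[OF generic, of 3 4 1 x0] distinct that
    by (simp_all add: h2_def second_special_swap)
  have not_boundary: "g x0 \<noteq> 0"
    if "first_special \<gamma> T (x0 $ 1) (x0 $ 3) \<or> second_special \<gamma> T (x0 $ 1) (x0 $ 3)"
    using special_pair_far_from_diagonal[OF adm that] boundary by (fastforce simp: g_def)
  have indep: "\<forall>i\<in>?J. a i x0 = 0 \<longrightarrow> c i = 0"
    if sum: "(\<Sum>i | i \<in> ?J \<and> a i x0 = 0. c i *\<^sub>R grad (a i) x0) = 0" for c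
  proof -
    \<comment> \<open>Inactive constraints get the coefficient zero, so that all three gradients take part.\<close>
  define c' where "c' = (\<lambda>i. if a i x0 = 0 then c i else 0)"
    have "(\<Sum>i\<in>?J. c' i *\<^sub>R grad (a i) x0) = (\<Sum>i | i \<in> ?J \<and> a i x0 = 0. c i *\<^sub>R grad (a i) x0)"
      by (rule sum.mono_neutral_cong_right) (auto simp: c'_def)
    then have "c' 1 *\<^sub>R ?p + (- c' 2) *\<^sub>R ?q + c' 3 *\<^sub>R grad g x0 = 0"
      using sum grad_uminus[OF smooth(2)] by (simp add: a_def algebra_simps)
    then have "c' 1 = 0 \<and> - c' 2 = 0 \<and> c' 3 = 0"
    proof (rule independent_constraint_gradients)
      show "?p $ 4 = 0" "?q $ 2 = 0"
        unfolding h1_def h2_def by (rule grad_height(4); simp)+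
      show "grad g x0 $ 2 = 0" "grad g x0 $ 4 = 0" "grad g x0 \<noteq> 0"
        using \<sigma>(1) by (auto simp: grad_g axis_def vec_eq_iff)
      have 1: "h1 x0 = 0" if "c' 1 \<noteq> 0" using that by (auto simp: c'_def a_def split: if_splits)
      have 2: "h2 x0 = 0" if "- c' 2 \<noteq> 0" using that by (auto simp: c'_def a_def split: if_splits)
      have 3: "c' 3 = 0" if "g x0 \<noteq> 0" using that by (auto simp: c'_def a_def)
      show "c' 1 \<noteq> 0 \<Longrightarrow> ?p \<noteq> 0"
        using 1 first(2) by (cases "?p $ 2 = 0") auto
      show "- c' 2 \<noteq> 0 \<Longrightarrow> ?q \<noteq> 0"
        using 2 second(2) by (cases "?q $ 4 = 0") auto
      show "c' 1 \<noteq> 0 \<Longrightarrow> ?p $ 2 = 0 \<Longrightarrow> c' 3 = 0 \<and> (- c' 2 \<noteq> 0 \<longrightarrow> ?q $ 4 \<noteq> 0)"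
        using 1 2 3 first(1) second(1) not_boundary not_first_and_second_special[OF generic] by blast
      show "- c' 2 \<noteq> 0 \<Longrightarrow> ?q $ 4 = 0 \<Longrightarrow> c' 3 = 0 \<and> (c' 1 \<noteq> 0 \<longrightarrow> ?p $ 2 \<noteq> 0)"
        using 1 2 3 first(1) second(1) not_boundary not_first_and_second_special[OF generic] by blast
    qed
    then show ?thesis by (auto simp: c'_def)
  qed
  have "smooth_on UNIV (a i)" "smooth_on UNIV (b i)" for i
    using smooth by (auto simp: a_def b_def intro!: smooth_intros)
  then obtain \<eta> where \<eta>: "\<eta> > 0" and corner: "\<And>\<epsilon> x. \<bar>\<epsilon>\<bar> < \<eta> \<Longrightarrow> x \<in> ball x0 \<eta> \<Longrightarrow>
      (\<forall>i\<in>?J. 0 \<le> a i x + \<epsilon> * b i x) \<Longrightarrow> corner_point {y. \<forall>i\<in>?J. 0 \<le> a i y + \<epsilon> * b i y} x"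
    using transverse_inequalities_stable[of ?J a b x0, OF _ _ _ indep] by auto
  have local: "x \<in> lifted_chords \<gamma> T \<delta> \<epsilon> \<longleftrightarrow> (\<forall>i\<in>?J. 0 \<le> a i x + \<epsilon> * b i x)"
    if "x \<in> ball x0 (r / 2)" for x \<epsilon>
  proof -
    have "\<bar>x $ 3 - x0 $ 3\<bar> < r / 2" "\<bar>x $ 1 - x0 $ 1\<bar> < r / 2"
      using that component_le_norm_cart[of "x - x0" 3] component_le_norm_cart[of "x - x0" 1]
      by (simp_all add: dist_norm norm_minus_commute)
    then have "\<bar>(x $ 3 - x $ 1) - (x0 $ 3 - x0 $ 1)\<bar> < r" by linarith
    from half_space[OF this] show ?thesis
      unfolding ab by (simp add: lifted_chords_def g_def)
  qed
  have "corner_point (lifted_chords \<gamma> T \<delta> \<epsilon>) x"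
    if "\<bar>\<epsilon>\<bar> < min \<eta> (r / 2)" "x \<in> ball x0 (min \<eta> (r / 2))" "x \<in> lifted_chords \<gamma> T \<delta> \<epsilon>" for \<epsilon> x
  proof (rule corner_point_local[OF corner])
    show "\<bar>\<epsilon>\<bar> < \<eta>" "x \<in> ball x0 \<eta>" "open (ball x0 (r / 2))" "x \<in> ball x0 (r / 2)"
      using that by auto
    then show "\<forall>i\<in>?J. 0 \<le> a i x + \<epsilon> * b i x"
      using local that(3) by blast
    show "{y. \<forall>i\<in>?J. 0 \<le> a i y + \<epsilon> * b i y} \<inter> ball x0 (r / 2) = lifted_chords \<gamma> T \<delta> \<epsilon> \<inter> ball x0 (r / 2)"
      using local by blast
  qed
  then show ?thesis
    using \<eta> \<sigma>(2) by (intro exI[of _ "min \<eta> (r / 2)"]) auto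
qed

end

section \<open>The space of outward-pointing chords\<close>

context frenet_curve
begin

lemma tube_periodic:
  assumes "\<And>s t. circle_class T s = circle_class T t \<Longrightarrow> \<gamma> s = \<gamma> t"
    and s: "circle_class T s = circle_class T s'" and \<theta>: "circle_class (2 * pi) \<theta> = circle_class (2 * pi) \<theta>'"
  shows "tube_normal \<gamma> s \<theta> = tube_normal \<gamma> s' \<theta>'" "tube \<gamma> \<epsilon> s \<theta> = tube \<gamma> \<epsilon> s' \<theta>'"
proof -
  obtain k :: int where k: "s' = s + of_int k * T" using s circle_class_eq_iff by blast
  have \<gamma>: "\<gamma> (r + of_int k * T) = \<gamma> r" for r
    using assms(1) circle_class_eq_iff by metis
  have vel: "velocity \<gamma> (r + of_int k * T) = velocity \<gamma> r" for r
    unfolding velocity_def by (rule vector_derivative_periodic[OF smooth \<gamma>])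
  have acc: "acceleration \<gamma> (r + of_int k * T) = acceleration \<gamma> r" for r
    unfolding acceleration_def by (rule vector_derivative_periodic[OF smooth_velocity vel])
  obtain l :: int where "\<theta>' = \<theta> + 2 * pi * of_int l"
    using \<theta> unfolding circle_class_eq_iff by (auto simp: mult.commute)
  then have "sin \<theta>' = sin \<theta> \<and> cos \<theta>' = cos \<theta>"
    using sin_cos_eq_iff by blast
  then show "tube_normal \<gamma> s \<theta> = tube_normal \<gamma> s' \<theta>'"
    by (simp add: tube_normal_def binormal_def normal_def k vel acc)
  then show "tube \<gamma> \<epsilon> s \<theta> = tube \<gamma> \<epsilon> s' \<theta>'"
    by (simp add: tube_def k \<gamma>)
qed

text \<open>Hence the inequalities, stated for representatives, are conditions on chords.\<close>

lemma F_periodic: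
  assumes "\<And>s t. circle_class T s = circle_class T t \<Longrightarrow> \<gamma> s = \<gamma> t" "chord_class T x = chord_class T y"
  shows "F1 \<gamma> \<epsilon> (x $ 1) (x $ 2) (x $ 3) (x $ 4) = F1 \<gamma> \<epsilon> (y $ 1) (y $ 2) (y $ 3) (y $ 4)"
    and "F2 \<gamma> \<epsilon> (x $ 1) (x $ 2) (x $ 3) (x $ 4) = F2 \<gamma> \<epsilon> (y $ 1) (y $ 2) (y $ 3) (y $ 4)"
proof -
  have "circle_class T (x $ 1) = circle_class T (y $ 1)" "circle_class (2 * pi) (x $ 2) = circle_class (2 * pi) (y $ 2)"
    and "circle_class T (x $ 3) = circle_class T (y $ 3)" "circle_class (2 * pi) (x $ 4) = circle_class (2 * pi) (y $ 4)"
    using assms(2) by (simp_all add: chord_class_def)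
  note * = tube_periodic[OF assms(1) this(1,2)] tube_periodic[OF assms(1) this(3,4)]
  show "F1 \<gamma> \<epsilon> (x $ 1) (x $ 2) (x $ 3) (x $ 4) = F1 \<gamma> \<epsilon> (y $ 1) (y $ 2) (y $ 3) (y $ 4)"
    and "F2 \<gamma> \<epsilon> (x $ 1) (x $ 2) (x $ 3) (x $ 4) = F2 \<gamma> \<epsilon> (y $ 1) (y $ 2) (y $ 3) (y $ 4)"
    by (simp_all add: F1_def F2_def *)
qed

lemma continuous_on_F:
  "continuous_on UNIV (\<lambda>x :: real ^ 4. F1 \<gamma> \<epsilon> (x $ 1) (x $ 2) (x $ 3) (x $ 4))"
  "continuous_on UNIV (\<lambda>x :: real ^ 4. F2 \<gamma> \<epsilon> (x $ 1) (x $ 2) (x $ 3) (x $ 4))"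
  unfolding F1_eq F2_eq
  by (intro smooth_on_imp_continuous_on smooth_intros smooth_height smooth_tube_normal open_UNIV)+

text \<open>Off the diagonal the closure adds nothing: the covering map is open, so a point of \<open>\<real>\<^sup>4\<close> with
  \<open>F\<^sub>i < 0\<close> has a neighbourhood whose image meets no chord with \<open>F\<^sub>i \<ge> 0\<close>.\<close>

lemma vimage_outward_chords:
  assumes "\<And>s t. circle_class T s = circle_class T t \<Longrightarrow> \<gamma> s = \<gamma> t" "0 < \<delta>"
  shows "chord_class T -` (outward_chords \<gamma> T \<epsilon> \<inter> off_diagonal T \<delta>) = lifted_chords \<gamma> T \<delta> \<epsilon>"
proof -
  let ?F1 = "\<lambda>x :: real ^ 4. F1 \<gamma> \<epsilon> (x $ 1) (x $ 2) (x $ 3) (x $ 4)"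
  let ?F2 = "\<lambda>x :: real ^ 4. F2 \<gamma> \<epsilon> (x $ 1) (x $ 2) (x $ 3) (x $ 4)"
  let ?A = "{x :: real ^ 4. 0 \<le> ?F1 x \<and> 0 \<le> ?F2 x \<and> circle_class T (x $ 1) \<noteq> circle_class T (x $ 3)}"
  have chords: "outward_chords \<gamma> T \<epsilon> = chord_space T closure_of (chord_class T ` ?A)"
  proof -
    have "{((circle_class T s1, circle_class (2 * pi) \<theta>1), (circle_class T s2, circle_class (2 * pi) \<theta>2)) | s1 \<theta>1 s2 \<theta>2.
          F1 \<gamma> \<epsilon> s1 \<theta>1 s2 \<theta>2 \<ge> 0 \<and> F2 \<gamma> \<epsilon> s1 \<theta>1 s2 \<theta>2 \<ge> 0 \<and> circle_class T s1 \<noteq> circle_class T s2} = chord_class T ` ?A"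
      (is "?B = _")
    proof
      show "chord_class T ` ?A \<subseteq> ?B"
        unfolding chord_class_def by (rule image_subsetI) blast
      show "?B \<subseteq> chord_class T ` ?A"
      proof
        fix q assume "q \<in> ?B"
        then obtain s1 \<theta>1 s2 \<theta>2 where *: "F1 \<gamma> \<epsilon> s1 \<theta>1 s2 \<theta>2 \<ge> 0" "F2 \<gamma> \<epsilon> s1 \<theta>1 s2 \<theta>2 \<ge> 0" "circle_class T s1 \<noteq> circle_class T s2"
            "q = ((circle_class T s1, circle_class (2 * pi) \<theta>1), (circle_class T s2, circle_class (2 * pi) \<theta>2))"
          by blast
        obtain x :: "real ^ 4" where "x $ 1 = s1" "x $ 2 = \<theta>1" "x $ 3 = s2" "x $ 4 = \<theta>2"
          using ex_vec4 by blast
        then show "q \<in> chord_class T ` ?A"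
          using * by (intro image_eqI[of _ _ x]) (auto simp: chord_class_def)
      qed
    qed
    then show ?thesis by (simp add: outward_chords_def)
  qed
  have top: "chord_class T x \<in> topspace (chord_space T)" for x
    using range_chord_class by blast
  have off: "chord_class T x \<in> off_diagonal T \<delta> \<longleftrightarrow> (\<forall>k :: int. \<delta> \<le> \<bar>x $ 3 - x $ 1 + of_int k * T\<bar>)" for x
    using top[of x] by (simp add: off_diagonal_def chord_class_def le_circle_dist_iff)
  have "x \<in> lifted_chords \<gamma> T \<delta> \<epsilon>" if x: "chord_class T x \<in> outward_chords \<gamma> T \<epsilon> \<inter> off_diagonal T \<delta>" for x
  proof -
    have "0 \<le> G x"
      if "continuous_on UNIV G" "\<And>y z. chord_class T y = chord_class T z \<Longrightarrow> G y = G z" "\<And>y. y \<in> ?A \<Longrightarrow> 0 \<le> G y"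
      for G :: "real ^ 4 \<Rightarrow> real"
    proof (rule ccontr)
      assume "\<not> 0 \<le> G x"
      then have "x \<in> G -` {..<0}" by simp
      moreover have "open (G -` {..<0})"
        using that(1) by (simp add: continuous_on_open_vimage)
      ultimately have W: "openin (chord_space T) (chord_class T ` (G -` {..<0}))" "chord_class T x \<in> chord_class T ` (G -` {..<0})"
        using open_map_chord_class by (simp_all add: open_map_def)
      have cl: "chord_class T x \<in> chord_space T closure_of (chord_class T ` ?A)"
        using x unfolding chords by (rule IntD1)
      obtain q where "q \<in> chord_class T ` ?A" "q \<in> chord_class T ` (G -` {..<0})"
        using in_closure_of[THEN iffD1, THEN conjunct2, rule_format, OF cl conjI[OF W(2,1)]] by (elim exE conjE)
      then obtain y z where yz: "y \<in> ?A" "z \<in> G -` {..<0}" "chord_class T y = chord_class T z"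
        by (elim imageE) simp
      then have "G z < 0" by simp
      then show False using that(2)[OF yz(3)] that(3)[OF yz(1)] by simp
    qed
    note closed_condition = this
    have "0 \<le> ?F1 x"
      by (rule closed_condition[OF continuous_on_F(1) F_periodic(1)[OF assms(1)]]) simp_all
    moreover have "0 \<le> ?F2 x"
      by (rule closed_condition[OF continuous_on_F(2) F_periodic(2)[OF assms(1)]]) simp_all
    moreover have "\<forall>k :: int. \<delta> \<le> \<bar>x $ 3 - x $ 1 + of_int k * T\<bar>"
      using x unfolding off[symmetric] by (rule IntD2)
    ultimately show ?thesis unfolding lifted_chords_def by blast
  qed
  moreover have "chord_class T x \<in> outward_chords \<gamma> T \<epsilon> \<inter> off_diagonal T \<delta>" if x: "x \<in> lifted_chords \<gamma> T \<delta> \<epsilon>" for x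
  proof
    show "chord_class T x \<in> off_diagonal T \<delta>" using x off by (simp add: lifted_chords_def)
    have "circle_class T (x $ 1) \<noteq> circle_class T (x $ 3)"
    proof
      assume "circle_class T (x $ 1) = circle_class T (x $ 3)"
      then obtain k :: int where "x $ 3 = x $ 1 + of_int k * T"
        unfolding circle_class_eq_iff by blast
      moreover have "\<delta> \<le> \<bar>x $ 3 - x $ 1 + of_int (- k) * T\<bar>"
        using x unfolding lifted_chords_def by blast
      ultimately show False using assms(2) by simp
    qed
    then have "chord_class T x \<in> chord_class T ` ?A"
      using x by (auto simp: lifted_chords_def)
    moreover have "chord_class T ` ?A \<subseteq> topspace (chord_space T)" using top by blast
    ultimately show "chord_class T x \<in> outward_chords \<gamma> T \<epsilon>"
      unfolding chords using closure_of_subset by blast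
  qed
  ultimately show ?thesis by blast
qed

text \<open>Finitely many of the neighbourhoods of the local result cover the part of \<open>C\<close> at
  distance at least \<open>\<delta>\<close> from the diagonal, and the
  smallest of their bounds on \<open>\<epsilon>\<close> serves for all of \<open>C\<close>.\<close>

lemma thin_tube_corner_points:
  assumes "generic_knot \<gamma> T" "admissible_delta \<gamma> T \<delta>" "compact C"
  shows "\<exists>\<epsilon>0>0. \<forall>\<epsilon>. 0 < \<epsilon> \<and> \<epsilon> < \<epsilon>0 \<longrightarrow>
     (\<forall>x\<in>C \<inter> lifted_chords \<gamma> T \<delta> \<epsilon>. corner_point (lifted_chords \<gamma> T \<delta> \<epsilon>) x)"
proof -
  define D where "D = {x :: real ^ 4. \<forall>k :: int. \<delta> \<le> \<bar>x $ 3 - x $ 1 + of_int k * T\<bar>}"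
  have "closed {x :: real ^ 4. \<delta> \<le> \<bar>x $ 3 - x $ 1 + of_int k * T\<bar>}" for k :: int
    by (intro closed_Collect_le continuous_intros)
  then have "closed D" unfolding D_def by (rule closed_Collect_all)
  then have "compact (C \<inter> D)" using assms(3) by blast
  have "\<forall>x0\<in>C \<inter> D. \<exists>\<eta>>0. \<forall>\<epsilon> x. \<bar>\<epsilon>\<bar> < \<eta> \<longrightarrow> x \<in> ball x0 \<eta> \<longrightarrow> x \<in> lifted_chords \<gamma> T \<delta> \<epsilon> \<longrightarrow>
      corner_point (lifted_chords \<gamma> T \<delta> \<epsilon>) x"
    using lifted_chords_corner_point_near[OF assms(1,2)] by (auto simp: D_def)
  then obtain \<eta> where \<eta>: "\<And>x0. x0 \<in> C \<inter> D \<Longrightarrow> 0 < \<eta> x0"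
    and corner: "\<And>x0 \<epsilon> x. x0 \<in> C \<inter> D \<Longrightarrow> \<bar>\<epsilon>\<bar> < \<eta> x0 \<Longrightarrow> x \<in> ball x0 (\<eta> x0) \<Longrightarrow>
        x \<in> lifted_chords \<gamma> T \<delta> \<epsilon> \<Longrightarrow> corner_point (lifted_chords \<gamma> T \<delta> \<epsilon>) x"
    by metis
  have "C \<inter> D \<subseteq> (\<Union>x0\<in>C \<inter> D. ball x0 (\<eta> x0))"
    using \<eta> by fastforce
  then obtain N where N: "N \<subseteq> C \<inter> D" "finite N" "C \<inter> D \<subseteq> (\<Union>x0\<in>N. ball x0 (\<eta> x0))"
    using compactE_image[OF \<open>compact (C \<inter> D)\<close>, of "C \<inter> D" "\<lambda>x0. ball x0 (\<eta> x0)"] by auto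
  define \<epsilon>0 where "\<epsilon>0 = Min (insert 1 (\<eta> ` N))"
  have "0 < \<epsilon>0" using N \<eta> by (auto simp: \<epsilon>0_def)
  moreover have "corner_point (lifted_chords \<gamma> T \<delta> \<epsilon>) x"
    if "0 < \<epsilon>" "\<epsilon> < \<epsilon>0" "x \<in> C" "x \<in> lifted_chords \<gamma> T \<delta> \<epsilon>" for \<epsilon> x
  proof -
    have "x \<in> C \<inter> D" using that by (auto simp: lifted_chords_def D_def)
    then obtain x0 where x0: "x0 \<in> N" "x \<in> ball x0 (\<eta> x0)" using N(3) by blast
    then have "\<epsilon>0 \<le> \<eta> x0" using N(2) by (simp add: \<epsilon>0_def)
    then show ?thesis
      using corner[of x0 \<epsilon> x] x0 N(1) that by auto
  qed
  ultimately show ?thesis by (intro exI[of _ \<epsilon>0]) auto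
qed

end

lemma ex_circle_representative:
  assumes "P > 0"
  shows "\<exists>t. circle_class P t = circle_class P s \<and> 0 \<le> t \<and> t \<le> P"
proof (intro exI conjI)
  let ?t = "s - of_int \<lfloor>s / P\<rfloor> * P"
  show "0 \<le> ?t" "?t \<le> P" using floor_div_mult[OF assms, of s] by auto
  have "s = ?t + of_int \<lfloor>s / P\<rfloor> * P" by simp
  then show "circle_class P ?t = circle_class P s" unfolding circle_class_eq_iff by blast
qed

theorem theorem1:
  fixes \<gamma> :: "real \<Rightarrow> real ^ 3" and T :: real
  assumes "generic_knot \<gamma> T"
  shows "(\<exists>\<delta>0>0. \<forall>\<delta>. 0 < \<delta> \<and> \<delta> < \<delta>0 \<longrightarrow> admissible_delta \<gamma> T \<delta>) \<and>
    (\<forall>\<delta>. admissible_delta \<gamma> T \<delta> \<longrightarrow>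
      (\<exists>\<epsilon>0>0. \<forall>\<epsilon>. 0 < \<epsilon> \<and> \<epsilon> < \<epsilon>0 \<longrightarrow>
        is_manifold_with_corners_in (chord_space T) (chord_space_atlas T :: (torus_pair, 4) chart set)
          (outward_chords \<gamma> T \<epsilon> \<inter> off_diagonal T \<delta>)))"
proof (intro conjI allI impI)
  have T: "T > 0" and fin: "finite (special_pairs \<gamma> T)"
    and periodic: "\<And>s t. circle_class T s = circle_class T t \<Longrightarrow> \<gamma> s = \<gamma> t"
    using assms by (auto simp: generic_knot_def smooth_knot_def)
  interpret frenet_curve \<gamma> using generic_knot_frenet_curve[OF assms] .
  show "\<exists>\<delta>0>0. \<forall>\<delta>. 0 < \<delta> \<and> \<delta> < \<delta>0 \<longrightarrow> admissible_delta \<gamma> T \<delta>"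
    by (rule small_delta_admissible[OF T fin])
  fix \<delta> assume adm: "admissible_delta \<gamma> T \<delta>"
  then have \<delta>: "0 < \<delta>" by (simp add: admissible_delta_def)
  \<comment> \<open>A box that contains a fundamental domain.\<close>
  define C :: "(real ^ 4) set" where "C = cbox 0 (\<chi> i. T + 2 * pi)"
  have rep: "\<exists>x\<in>C. chord_class T x = q" if q: "q \<in> topspace (chord_space T)" for q
  proof -
    obtain y where y: "q = chord_class T y"
      using q range_chord_class by (metis imageE)
    have "\<exists>t. circle_class P t = circle_class P s \<and> 0 \<le> t \<and> t \<le> T + 2 * pi" if "P = T \<or> P = 2 * pi" for P s
    proof -
      have "0 < P" "P \<le> T + 2 * pi" using that T pi_gt_zero by auto
      then show ?thesis
        using ex_circle_representative[of P s] by (metis order_trans)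
    qed
    then obtain t where t: "\<And>P s. P = T \<or> P = 2 * pi \<Longrightarrow>
        circle_class P (t P s) = circle_class P s \<and> 0 \<le> t P s \<and> t P s \<le> T + 2 * pi"
      by metis
    obtain x :: "real ^ 4" where x: "x $ 1 = t T (y $ 1)" "x $ 2 = t (2 * pi) (y $ 2)"
        "x $ 3 = t T (y $ 3)" "x $ 4 = t (2 * pi) (y $ 4)"
      using ex_vec4 by blast
    have "x \<in> C" using t by (simp add: C_def mem_box_cart forall_4 x)
    moreover have "chord_class T x = q" using t by (simp add: chord_class_def y x)
    ultimately show ?thesis by blast
  qed
  have "compact C" by (simp add: C_def compact_cbox)
  then obtain \<epsilon>0 where "\<epsilon>0 > 0" and corner: "\<And>\<epsilon> x. 0 < \<epsilon> \<Longrightarrow> \<epsilon> < \<epsilon>0 \<Longrightarrow>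
      x \<in> C \<Longrightarrow> x \<in> lifted_chords \<gamma> T \<delta> \<epsilon> \<Longrightarrow> corner_point (lifted_chords \<gamma> T \<delta> \<epsilon>) x"
    using thin_tube_corner_points[OF assms adm] by (metis IntI)
  have "is_manifold_with_corners_in (chord_space T) (chord_space_atlas T) (outward_chords \<gamma> T \<epsilon> \<inter> off_diagonal T \<delta>)"
    if \<epsilon>: "0 < \<epsilon>" "\<epsilon> < \<epsilon>0" for \<epsilon>
  proof (rule chord_space_manifold_with_cornersI[OF T])
    let ?X = "outward_chords \<gamma> T \<epsilon> \<inter> off_diagonal T \<delta>"
    show sub: "?X \<subseteq> topspace (chord_space T)" by (auto simp: off_diagonal_def)
    fix q assume q: "q \<in> ?X"
    then obtain x where x: "x \<in> C" "chord_class T x = q" using rep sub by blast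
    then have "x \<in> lifted_chords \<gamma> T \<delta> \<epsilon>"
      using q vimage_outward_chords[OF periodic \<delta>] by blast
    then show "\<exists>x. chord_class T x = q \<and> corner_point (chord_class T -` ?X) x"
      using corner[OF \<epsilon> x(1)] x(2) vimage_outward_chords[OF periodic \<delta>] by auto
  qed
  then show "\<exists>\<epsilon>0>0. \<forall>\<epsilon>. 0 < \<epsilon> \<and> \<epsilon> < \<epsilon>0 \<longrightarrow>
      is_manifold_with_corners_in (chord_space T) (chord_space_atlas T) (outward_chords \<gamma> T \<epsilon> \<inter> off_diagonal T \<delta>)"
    using \<open>\<epsilon>0 > 0\<close> by blast
qed

end
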